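(* Let $\mathbb{F}$ be a field and $0\neq h\in\mathbb{F}[x]$. An ideal $\mathsf{P}$ of $\mathsf{A}_h$ is primitive if and only if $\mathsf{P}$ is maximal, or $\mathrm{char}(\mathbb{F})=0$ and $\mathsf{P}=(0)$. In particular, if $\mathrm{char}(\mathbb{F})=0$, then $\mathsf{A}_h$ is a primitive algebra, and all infinite-dimensional irreducible $\mathsf{A}_h$-modules are faithful.
   Context: $\mathsf{A}_h$ is the unital associative $\mathbb{F}$-algebra with generators $x,y$ and defining relation $yx=xy+h$; throughout $h\neq 0$. Modules are left modules. A primitive ideal is the annihilator of an irreducible module; an algebra is primitive if it has a faithful irreducible module. "Maximal ideal" means maximal two-sided ideal. *)

theory Defs
  imports
    "HOL-Algebra.Algebra"
    "HOL-Algebra.Algebraic_Closure_Type"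
    "HOL-Library.Poly_Mapping"
begin

section \<open>Left modules, irreducibility, primitive ideals\<close>

text \<open>The library locale \<^locale>\<open>module\<close> requires a commutative ring; this is the same list of
  axioms over an arbitrary unital ring.\<close>

locale left_module = R?: ring R + M?: abelian_group M
  for R :: "('a, 'b) ring_scheme" (structure) and M :: "('a, 'm, 'z) module_scheme" (structure) +
  assumes smult_closed:
      "\<lbrakk>a \<in> carrier R; x \<in> carrier M\<rbrakk> \<Longrightarrow> a \<odot>\<^bsub>M\<^esub> x \<in> carrier M"
    and smult_l_distr:
      "\<lbrakk>a \<in> carrier R; b \<in> carrier R; x \<in> carrier M\<rbrakk> \<Longrightarrow>
        (a \<oplus> b) \<odot>\<^bsub>M\<^esub> x = a \<odot>\<^bsub>M\<^esub> x \<oplus>\<^bsub>M\<^esub> b \<odot>\<^bsub>M\<^esub> x"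
    and smult_r_distr:
      "\<lbrakk>a \<in> carrier R; x \<in> carrier M; y \<in> carrier M\<rbrakk> \<Longrightarrow>
        a \<odot>\<^bsub>M\<^esub> (x \<oplus>\<^bsub>M\<^esub> y) = a \<odot>\<^bsub>M\<^esub> x \<oplus>\<^bsub>M\<^esub> a \<odot>\<^bsub>M\<^esub> y"
    and smult_assoc1:
      "\<lbrakk>a \<in> carrier R; b \<in> carrier R; x \<in> carrier M\<rbrakk> \<Longrightarrow>
        (a \<otimes> b) \<odot>\<^bsub>M\<^esub> x = a \<odot>\<^bsub>M\<^esub> (b \<odot>\<^bsub>M\<^esub> x)"
    and smult_one:
      "x \<in> carrier M \<Longrightarrow> \<one> \<odot>\<^bsub>M\<^esub> x = x"

definition irreducible_module ::
    "('a, 'b) ring_scheme \<Rightarrow> ('a, 'm, 'z) module_scheme \<Rightarrow> bool" where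
  "irreducible_module R M \<longleftrightarrow>
     left_module R M \<and> carrier M \<noteq> {\<zero>\<^bsub>M\<^esub>} \<and>
     (\<forall>N. submodule N R M \<longrightarrow> N = {\<zero>\<^bsub>M\<^esub>} \<or> N = carrier M)"

definition annihilator ::
    "('a, 'b) ring_scheme \<Rightarrow> ('a, 'm, 'z) module_scheme \<Rightarrow> 'a set" where
  "annihilator R M = {a \<in> carrier R. \<forall>m \<in> carrier M. a \<odot>\<^bsub>M\<^esub> m = \<zero>\<^bsub>M\<^esub>}"

definition faithful_module ::
    "('a, 'b) ring_scheme \<Rightarrow> ('a, 'm, 'z) module_scheme \<Rightarrow> bool" where
  "faithful_module R M \<longleftrightarrow> annihilator R M = {\<zero>\<^bsub>R\<^esub>}"

text \<open>HOL cannot quantify over the carrier type of a module inside a formula. In the next two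
  definitions the elements of the module have type \<^typ>\<open>'a set\<close>, with \<^typ>\<open>'a\<close> the type of the ring
  elements. This is no restriction: an irreducible module is isomorphic to \<open>R / L\<close> for a left
  ideal \<open>L\<close>, whose elements are cosets. The lemmas \<open>primitive_ideal_annihilator\<close> and
  \<open>primitive_ringI\<close> below prove it for modules over any type.\<close>

definition primitive_ideal :: "('a, 'b) ring_scheme \<Rightarrow> 'a set \<Rightarrow> bool" where
  "primitive_ideal R P \<longleftrightarrow>
     (\<exists>M :: ('a, 'a set) module. irreducible_module R M \<and> annihilator R M = P)"

definition primitive_ring :: "('a, 'b) ring_scheme \<Rightarrow> bool" where
  "primitive_ring R \<longleftrightarrow>
     (\<exists>M :: ('a, 'a set) module. irreducible_module R M \<and> faithful_module R M)"

lemma (in left_module) smult_zero_right: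
  assumes "a \<in> carrier R" shows "a \<odot>\<^bsub>M\<^esub> \<zero>\<^bsub>M\<^esub> = \<zero>\<^bsub>M\<^esub>"
proof -
  have "a \<odot>\<^bsub>M\<^esub> \<zero>\<^bsub>M\<^esub> \<oplus>\<^bsub>M\<^esub> a \<odot>\<^bsub>M\<^esub> \<zero>\<^bsub>M\<^esub> = a \<odot>\<^bsub>M\<^esub> \<zero>\<^bsub>M\<^esub>"
    using smult_r_distr[OF assms M.zero_closed M.zero_closed] by simp
  then show ?thesis
    using smult_closed[OF assms M.zero_closed] M.add.r_cancel_one by blast
qed

lemma (in left_module) smult_zero_left:
  assumes "x \<in> carrier M" shows "\<zero> \<odot>\<^bsub>M\<^esub> x = \<zero>\<^bsub>M\<^esub>"
proof -
  have "\<zero> \<odot>\<^bsub>M\<^esub> x \<oplus>\<^bsub>M\<^esub> \<zero> \<odot>\<^bsub>M\<^esub> x = \<zero> \<odot>\<^bsub>M\<^esub> x"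
    using smult_l_distr[OF R.zero_closed R.zero_closed assms] by simp
  then show ?thesis
    using smult_closed[OF R.zero_closed assms] M.add.r_cancel_one by blast
qed

lemma (in left_module) smult_minus_left:
  assumes "a \<in> carrier R" "x \<in> carrier M" shows "(\<ominus> a) \<odot>\<^bsub>M\<^esub> x = \<ominus>\<^bsub>M\<^esub> (a \<odot>\<^bsub>M\<^esub> x)"
proof -
  have "(\<ominus> a) \<odot>\<^bsub>M\<^esub> x \<oplus>\<^bsub>M\<^esub> a \<odot>\<^bsub>M\<^esub> x = \<zero>\<^bsub>M\<^esub>"
    using smult_l_distr[of "\<ominus> a" a x] assms smult_zero_left R.l_neg by simp
  then show ?thesis
    using assms smult_closed M.minus_equality by (metis R.a_inv_closed)
qed

lemma submodule_iff:
  assumes "left_module R M"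
  shows "submodule N R M \<longleftrightarrow> N \<subseteq> carrier M \<and> \<zero>\<^bsub>M\<^esub> \<in> N \<and>
     (\<forall>x\<in>N. \<forall>y\<in>N. x \<oplus>\<^bsub>M\<^esub> y \<in> N) \<and> (\<forall>a\<in>carrier R. \<forall>x\<in>N. a \<odot>\<^bsub>M\<^esub> x \<in> N)"
    (is "?L \<longleftrightarrow> ?R")
proof
  assume ?L
  then interpret submodule N R M .
  show ?R
    using subset one_closed m_closed smult_closed by auto
next
  interpret left_module R M by fact
  assume N: ?R
  have "\<ominus>\<^bsub>M\<^esub> x \<in> N" if "x \<in> N" for x
  proof -
    have "x \<in> carrier M" using N that by blast
    then have "\<ominus>\<^bsub>M\<^esub> x = (\<ominus>\<^bsub>R\<^esub> \<one>\<^bsub>R\<^esub>) \<odot>\<^bsub>M\<^esub> x"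
      using smult_minus_left[of "\<one>\<^bsub>R\<^esub>" x] smult_one by simp
    then show ?thesis using N that by simp
  qed
  with N show ?L
    by unfold_locales (auto simp: a_inv_def)
qed

text \<open>Transport of structure along \<open>f\<close>. The record type of modules extends that of rings; its
  fields \<open>mult\<close> and \<open>one\<close> play no role in a module.\<close>

definition transport_module ::
    "('m \<Rightarrow> 'n) \<Rightarrow> ('a, 'm, 'z) module_scheme \<Rightarrow> ('a, 'n) module" where
  "transport_module f M =
     (let g = inv_into (carrier M) f in
      \<lparr>carrier = f ` carrier M, monoid.mult = undefined, one = undefined, ring.zero = f \<zero>\<^bsub>M\<^esub>,
       add = (\<lambda>x y. f (g x \<oplus>\<^bsub>M\<^esub> g y)), module.smult = (\<lambda>a x. f (a \<odot>\<^bsub>M\<^esub> g x))\<rparr>)"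

lemma transport_module:
  assumes inj: "inj_on f (carrier M)" and irr: "irreducible_module R M"
  shows "irreducible_module R (transport_module f M)"
    and "annihilator R (transport_module f M) = annihilator R M"
proof -
  interpret left_module R M using irr by (simp add: irreducible_module_def)
  let ?N = "transport_module f M"
  have [simp]: "inv_into (carrier M) f (f x) = x" if "x \<in> carrier M" for x
    using inj that by simp
  have [simp]: "carrier ?N = f ` carrier M" "\<zero>\<^bsub>?N\<^esub> = f \<zero>\<^bsub>M\<^esub>"
    by (simp_all add: transport_module_def Let_def)
  have add [simp]: "f x \<oplus>\<^bsub>?N\<^esub> f y = f (x \<oplus>\<^bsub>M\<^esub> y)" if "x \<in> carrier M" "y \<in> carrier M" for x y
    using that by (simp add: transport_module_def Let_def)
  have smult [simp]: "a \<odot>\<^bsub>?N\<^esub> f x = f (a \<odot>\<^bsub>M\<^esub> x)" if "x \<in> carrier M" for a x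
    using that by (simp add: transport_module_def Let_def)
  note [simp] = smult_closed
  have ag: "abelian_group ?N"
  proof (rule abelian_groupI)
    fix x assume "x \<in> carrier ?N"
    then obtain u where u: "u \<in> carrier M" "x = f u" by auto
    then show "\<exists>y\<in>carrier ?N. y \<oplus>\<^bsub>?N\<^esub> x = \<zero>\<^bsub>?N\<^esub>"
      by (auto simp: M.l_neg intro!: bexI[of _ "\<ominus>\<^bsub>M\<^esub> u"])
  qed (auto simp: M.a_ac)
  have lm: "left_module R ?N"
  proof (intro left_module.intro ag left_module_axioms.intro)
    show "ring R" by (rule R.ring_axioms)
  qed (auto simp: smult_l_distr smult_r_distr smult_assoc1 smult_one)
  have simple: "K = {\<zero>\<^bsub>?N\<^esub>} \<or> K = carrier ?N" if K: "submodule K R ?N" for K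
  proof -
    let ?K = "{x \<in> carrier M. f x \<in> K}"
    have img: "K = f ` ?K"
      using K by (auto simp: submodule_iff[OF lm])
    have "submodule ?K R M"
      unfolding submodule_iff[OF left_module_axioms]
    proof (intro conjI ballI)
      show "\<zero>\<^bsub>M\<^esub> \<in> ?K"
        using K M.zero_closed by (simp add: submodule_iff[OF lm])
      show "x \<oplus>\<^bsub>M\<^esub> y \<in> ?K" if "x \<in> ?K" "y \<in> ?K" for x y
        using K that add[of x y] M.a_closed[of x y] unfolding submodule_iff[OF lm] by force
      show "a \<odot>\<^bsub>M\<^esub> x \<in> ?K" if "a \<in> carrier R" "x \<in> ?K" for a x
        using K that smult[of x a] smult_closed[of a x] unfolding submodule_iff[OF lm] by force
    qed blast
    then have "?K = {\<zero>\<^bsub>M\<^esub>} \<or> ?K = carrier M"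
      using irr by (auto simp: irreducible_module_def)
    then show ?thesis
    proof
      assume "?K = {\<zero>\<^bsub>M\<^esub>}"
      with img have "K = f ` {\<zero>\<^bsub>M\<^esub>}" by metis
      then show ?thesis by simp
    next
      assume "?K = carrier M"
      with img have "K = f ` carrier M" by metis
      then show ?thesis by simp
    qed
  qed
  have eq0: "f x = f \<zero>\<^bsub>M\<^esub> \<longleftrightarrow> x = \<zero>\<^bsub>M\<^esub>" if "x \<in> carrier M" for x
    using inj_on_eq_iff[OF inj that M.zero_closed] .
  have "carrier ?N \<noteq> {\<zero>\<^bsub>?N\<^esub>}"
  proof
    assume *: "carrier ?N = {\<zero>\<^bsub>?N\<^esub>}"
    have "x = \<zero>\<^bsub>M\<^esub>" if "x \<in> carrier M" for x
    proof -
      have "f x \<in> carrier ?N" using that by simp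
      then have "f x = f \<zero>\<^bsub>M\<^esub>" unfolding * by simp
      then show ?thesis using eq0[OF that] by blast
    qed
    then have "carrier M = {\<zero>\<^bsub>M\<^esub>}" using M.zero_closed by blast
    then show False using irr unfolding irreducible_module_def by blast
  qed
  with lm simple show "irreducible_module R ?N"
    unfolding irreducible_module_def by blast
  have "(\<forall>m\<in>carrier ?N. a \<odot>\<^bsub>?N\<^esub> m = \<zero>\<^bsub>?N\<^esub>) \<longleftrightarrow> (\<forall>m\<in>carrier M. a \<odot>\<^bsub>M\<^esub> m = \<zero>\<^bsub>M\<^esub>)"
    if "a \<in> carrier R" for a
    using that by (simp add: eq0)
  then show "annihilator R ?N = annihilator R M"
    unfolding annihilator_def by blast
qed

text \<open>For a nonzero element \<open>v\<close> of an irreducible module, \<open>m \<mapsto> {a. a v = m}\<close> is injective.\<close>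

lemma irreducible_module_inj_into_sets:
  assumes irr: "irreducible_module R M"
  obtains f :: "'m \<Rightarrow> 'a set"
  where "inj_on f (carrier (M :: ('a, 'm, 'z) module_scheme))"
proof -
  interpret left_module R M using irr by (simp add: irreducible_module_def)
  obtain v where v: "v \<in> carrier M" "v \<noteq> \<zero>\<^bsub>M\<^esub>"
    using irr M.zero_closed by (auto simp: irreducible_module_def)
  let ?N = "(\<lambda>a. a \<odot>\<^bsub>M\<^esub> v) ` carrier R"
  have "submodule ?N R M"
    unfolding submodule_iff[OF left_module_axioms]
  proof (intro conjI ballI)
    show "?N \<subseteq> carrier M" using v(1) smult_closed by blast
    show "\<zero>\<^bsub>M\<^esub> \<in> ?N"
      by (rule image_eqI[where x = "\<zero>\<^bsub>R\<^esub>"], rule smult_zero_left[OF v(1), symmetric], rule R.zero_closed)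
    show "x \<oplus>\<^bsub>M\<^esub> y \<in> ?N" if xy: "x \<in> ?N" "y \<in> ?N" for x y
    proof -
      obtain a b where ab: "a \<in> carrier R" "b \<in> carrier R" "x = a \<odot>\<^bsub>M\<^esub> v" "y = b \<odot>\<^bsub>M\<^esub> v"
        using xy by blast
      then have "x \<oplus>\<^bsub>M\<^esub> y = (a \<oplus>\<^bsub>R\<^esub> b) \<odot>\<^bsub>M\<^esub> v" using smult_l_distr v(1) by simp
      then show ?thesis using R.a_closed[OF ab(1,2)] by (rule image_eqI)
    qed
    show "a \<odot>\<^bsub>M\<^esub> x \<in> ?N" if ax: "a \<in> carrier R" "x \<in> ?N" for a x
    proof -
      obtain b where b: "b \<in> carrier R" "x = b \<odot>\<^bsub>M\<^esub> v" using ax(2) by blast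
      then have "a \<odot>\<^bsub>M\<^esub> x = (a \<otimes>\<^bsub>R\<^esub> b) \<odot>\<^bsub>M\<^esub> v" using smult_assoc1 v(1) ax(1) by simp
      then show ?thesis using R.m_closed[OF ax(1) b(1)] by (rule image_eqI)
    qed
  qed
  then have "?N = {\<zero>\<^bsub>M\<^esub>} \<or> ?N = carrier M"
    using irr unfolding irreducible_module_def by (elim conjE allE impE)
  moreover have "v \<in> ?N"
    by (rule image_eqI[where x = "\<one>\<^bsub>R\<^esub>"], rule smult_one[OF v(1), symmetric], rule R.one_closed)
  ultimately have N: "?N = carrier M"
    using v(2) by (metis singletonD)
  have "inj_on (\<lambda>m. {a \<in> carrier R. a \<odot>\<^bsub>M\<^esub> v = m}) (carrier M)"
  proof (rule inj_onI)
    fix m n assume "m \<in> carrier M"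
      and eq: "{a \<in> carrier R. a \<odot>\<^bsub>M\<^esub> v = m} = {a \<in> carrier R. a \<odot>\<^bsub>M\<^esub> v = n}"
    then have "m \<in> ?N" using N by metis
    then obtain a where "a \<in> carrier R" "a \<odot>\<^bsub>M\<^esub> v = m" by (metis imageE)
    with eq show "m = n" by blast
  qed
  then show ?thesis by (rule that)
qed

lemma primitive_ideal_annihilator:
  fixes M :: "('a, 'm, 'z) module_scheme"
  assumes "irreducible_module R M"
  shows "primitive_ideal R (annihilator R M)"
proof -
  obtain f :: "'m \<Rightarrow> 'a set" where "inj_on f (carrier M)"
    using irreducible_module_inj_into_sets[OF assms] .
  from transport_module[OF this assms] show ?thesis
    unfolding primitive_ideal_def by blast
qed

lemma primitive_ringI:
  fixes M :: "('a, 'm, 'z) module_scheme"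
  assumes "irreducible_module R M" "faithful_module R M"
  shows "primitive_ring R"
  using primitive_ideal_annihilator[OF assms(1)] assms(2)
  unfolding primitive_ideal_def primitive_ring_def faithful_module_def by auto


section \<open>The algebra generated by \<open>x\<close>, \<open>y\<close> with \<open>y x = x y + h\<close>\<close>

datatype generator = GenX | GenY

text \<open>The free monoid on the two generators, written additively because \<^theory>\<open>HOL-Library.Poly_Mapping\<close>
  puts the convolution product on \<open>'m \<Rightarrow>\<^sub>0 'f\<close> for an additive monoid \<open>'m\<close> of exponents.\<close>

datatype gen_word = Word (letters: "generator list")

instantiation gen_word :: monoid_add
begin
definition zero_gen_word :: gen_word where "0 = Word []"
definition plus_gen_word :: "gen_word \<Rightarrow> gen_word \<Rightarrow> gen_word"
  where "v + w = Word (letters v @ letters w)"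
instance by standard (simp_all add: zero_gen_word_def plus_gen_word_def)
end

text \<open>The free unital associative algebra on \<open>x\<close>, \<open>y\<close>.\<close>

type_synonym 'f free_algebra = "gen_word \<Rightarrow>\<^sub>0 'f"

definition free_gen :: "generator \<Rightarrow> 'f::field free_algebra" where
  "free_gen g = Poly_Mapping.single (Word [g]) 1"

definition free_const :: "'f \<Rightarrow> 'f::field free_algebra" where
  "free_const c = Poly_Mapping.single 0 c"

text \<open>The element \<open>y x - x y - h(x)\<close>.\<close>

definition Ah_relator :: "'f::field poly \<Rightarrow> 'f free_algebra" where
  "Ah_relator h =
     free_gen GenY * free_gen GenX - free_gen GenX * free_gen GenY
       - (\<Sum>i\<le>Polynomial.degree h. free_const (Polynomial.coeff h i) * free_gen GenX ^ i)"

definition Ah_ideal :: "'f::field poly \<Rightarrow> 'f free_algebra set" where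
  "Ah_ideal h = Idl\<^bsub>ring_of_type_algebra\<^esub> {Ah_relator h}"

definition Ah :: "'f::field poly \<Rightarrow> 'f free_algebra set ring" where
  "Ah h = ring_of_type_algebra Quot Ah_ideal h"

definition Ah_const :: "'f::field poly \<Rightarrow> 'f \<Rightarrow> 'f free_algebra set" where
  "Ah_const h c = Ah_ideal h +>\<^bsub>ring_of_type_algebra\<^esub> free_const c"

text \<open>Finite-dimensionality over the base field, which acts on an \<^term>\<open>Ah h\<close>-module through
  \<^term>\<open>Ah_const h\<close>: some finite set spans.\<close>

definition Ah_finite_dim ::
    "'f::field poly \<Rightarrow> ('f free_algebra set, 'm, 'z) module_scheme \<Rightarrow> bool" where
  "Ah_finite_dim h M \<longleftrightarrow>
     (\<exists>B. finite B \<and> B \<subseteq> carrier M \<and>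
        (\<forall>m \<in> carrier M. \<exists>c :: 'm \<Rightarrow> 'f.
           m = (\<Oplus>\<^bsub>M\<^esub>b\<in>B. Ah_const h (c b) \<odot>\<^bsub>M\<^esub> b)))"

lemma ring_of_type_ring_1: "ring (ring_of_type_algebra :: 'a::ring_1 ring)"
proof -
  have "\<exists>y. x + y = 0" for x :: 'a
    using add.right_inverse by blast
  then show ?thesis
    unfolding ring_of_type_algebra_def
    by unfold_locales (auto simp: algebra_simps Units_def)
qed

lemma ideal_Ah_ideal: "ideal (Ah_ideal h) ring_of_type_algebra"
  unfolding Ah_ideal_def
  by (rule ring.genideal_ideal[OF ring_of_type_ring_1]) (simp add: ring_of_type_algebra_def)

lemma ring_Ah: "ring (Ah h)"
  unfolding Ah_def by (rule ideal.quotient_is_ring[OF ideal_Ah_ideal])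

end

theory Submission
  imports Defs
begin

text \<open>
  For a maximal left ideal \<open>L\<close> of a ring \<open>R\<close>, let the core of \<open>L\<close> be the annihilator of \<open>R / L\<close>;
  the primitive ideals are the cores, and every maximal ideal is one.

  If \<open>R / L\<close> is finitely generated over elements that are central modulo the core, then the core is
  maximal: a two-sided ideal \<open>J\<close> strictly above the core contains, for finitely many elements of
  \<open>R / L\<close>, an \<open>e\<close> fixing all of them; applied to generators, \<open>1 - e\<close> lies in the core, so
  \<open>1 \<in> J\<close>. In characteristic \<open>p\<close> this applies to the central elements \<open>x\<^sup>p\<close> and \<open>y\<^sup>p - c y\<close>.

  In characteristic 0, commutators with \<open>x\<close> bring a nonzero element of the core to a nonzero polynomial
  in \<open>x\<close>, and then commutators with \<open>y\<close> bring this to a power of \<open>h\<close>. As \<open>h R = R h\<close> modulo the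
  relation, \<open>h\<close> itself lies in the core, and the quotient by the core is a commutative ring, in fact a
  field, which is finite-dimensional. A maximal left ideal that contains \<open>1 - x h\<close> cannot contain \<open>h\<close>,
  so its core is zero.
\<close>

section \<open>Left ideals and their cores\<close>

text \<open>An irreducible module in characteristic p is not known in advance to be
  finite-dimensional, and over an arbitrary field a central element need not act on it by a scalar.
  So the argument uses only finite generation over central elements, and the element e from the
  two-sided ideal does the work of a dimension count.

  In characteristic 0 the passage from a power of h to h rests on normality: h R + L is a left
  ideal, so on the simple module R / L the element h acts either as zero or surjectively, and in the
  second case no power of h acts as zero.

  The element 1 - x h is comaximal with h by construction, and its degree is deg h + 1, so it is not
  a unit of F[x] even if h is constant. That it generates a proper left ideal of the quotient is
  read off from a right action on F[x].\<close>

definition left_ideal :: "'r::ring_1 set \<Rightarrow> bool" where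
  "left_ideal L \<longleftrightarrow> 0 \<in> L \<and> (\<forall>a\<in>L. \<forall>b\<in>L. a + b \<in> L) \<and> (\<forall>r. \<forall>a\<in>L. r * a \<in> L)"

definition two_sided_ideal :: "'r::ring_1 set \<Rightarrow> bool" where
  "two_sided_ideal I \<longleftrightarrow> left_ideal I \<and> (\<forall>r. \<forall>a\<in>I. a * r \<in> I)"

text \<open>Maximality is stated as \<open>L + R a = R\<close> for \<open>a \<notin> L\<close>, which avoids quantifying over ideals.
  The core below is the annihilator of the module \<open>R / L\<close>.\<close>

definition max_left_ideal :: "'r::ring_1 set \<Rightarrow> bool" where
  "max_left_ideal L \<longleftrightarrow> left_ideal L \<and> 1 \<notin> L \<and> (\<forall>a. a \<notin> L \<longrightarrow> (\<exists>r. 1 - r * a \<in> L))"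

definition core :: "'r::ring_1 set \<Rightarrow> 'r set" where
  "core L = {a. \<forall>r. a * r \<in> L}"

lemma left_ideal_zero: "left_ideal L \<Longrightarrow> 0 \<in> L"
  and left_ideal_add: "left_ideal L \<Longrightarrow> a \<in> L \<Longrightarrow> b \<in> L \<Longrightarrow> a + b \<in> L"
  and left_ideal_mult: "left_ideal L \<Longrightarrow> a \<in> L \<Longrightarrow> r * a \<in> L"
  by (auto simp: left_ideal_def)

lemma left_ideal_uminus: "left_ideal L \<Longrightarrow> a \<in> L \<Longrightarrow> - a \<in> L"
  using left_ideal_mult[of L a "- 1"] by simp

lemma left_ideal_diff: "left_ideal L \<Longrightarrow> a \<in> L \<Longrightarrow> b \<in> L \<Longrightarrow> a - b \<in> L"
  using left_ideal_add[of L a "- b"] left_ideal_uminus[of L b] by simp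

lemma left_ideal_diff_iff:
  assumes "left_ideal L" "a - b \<in> L" shows "a \<in> L \<longleftrightarrow> b \<in> L"
proof
  assume "a \<in> L"
  from left_ideal_diff[OF assms(1) this assms(2)] show "b \<in> L" by simp
next
  assume "b \<in> L"
  from left_ideal_add[OF assms(1,2) this] show "a \<in> L" by simp
qed

lemma left_ideal_cong_sym: "left_ideal L \<Longrightarrow> a - b \<in> L \<Longrightarrow> b - a \<in> L"
  using left_ideal_uminus[of L "a - b"] by simp

lemma two_sided_idealD: "two_sided_ideal I \<Longrightarrow> left_ideal I"
  by (simp add: two_sided_ideal_def)

lemma two_sided_ideal_mult_right: "two_sided_ideal I \<Longrightarrow> a \<in> I \<Longrightarrow> a * r \<in> I"
  by (simp add: two_sided_ideal_def)

lemma max_left_idealD: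
  assumes "max_left_ideal L"
  shows "left_ideal L" "1 \<notin> L" "a \<notin> L \<Longrightarrow> \<exists>r. 1 - r * a \<in> L"
  using assms by (auto simp: max_left_ideal_def)

lemma core_subset: "core L \<subseteq> L"
proof
  fix a assume "a \<in> core L"
  then have "a * 1 \<in> L" unfolding core_def by blast
  then show "a \<in> L" by simp
qed

lemma two_sided_ideal_core:
  assumes "left_ideal L" shows "two_sided_ideal (core L)"
proof -
  have "a * r * s \<in> L" if "a \<in> core L" for a r s
    using that by (simp add: core_def mult.assoc)
  then show ?thesis
    using assms
    by (simp add: two_sided_ideal_def left_ideal_def core_def distrib_right mult.assoc)
qed

lemma two_sided_ideal_subset_core:
  assumes "two_sided_ideal I" "I \<subseteq> L" shows "I \<subseteq> core L"
  using assms by (auto simp: core_def two_sided_ideal_def)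

lemma max_left_ideal_bigger:
  assumes "max_left_ideal L" "left_ideal K" "L \<subseteq> K" "a \<in> K" "a \<notin> L"
  shows "K = UNIV"
proof -
  obtain r where "1 - r * a \<in> L" using max_left_idealD(3)[OF assms(1,5)] ..
  then have "1 - r * a + r * a \<in> K"
    using assms(3,4) left_ideal_add[OF assms(2)] left_ideal_mult[OF assms(2)] by blast
  then have "r * 1 \<in> K" for r
    by (intro left_ideal_mult[OF assms(2)]) simp
  then show ?thesis by auto
qed

text \<open>Zorn's lemma for left ideals that omit 1; maximality under inclusion becomes the
  elementwise form by testing it on L + R a.\<close>

lemma exists_max_left_ideal:
  fixes L0 :: "'r::ring_1 set"
  assumes "left_ideal L0" "1 \<notin> L0"
  obtains L where "max_left_ideal L" "L0 \<subseteq> L"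
proof -
  let ?A = "{L. left_ideal L \<and> 1 \<notin> L \<and> L0 \<subseteq> L}"
  have "\<exists>L\<in>?A. \<forall>K\<in>?A. L \<subseteq> K \<longrightarrow> K = L"
  proof (rule subset_Zorn_nonempty)
    show "?A \<noteq> {}" using assms by blast
    fix C assume C: "C \<noteq> {}" "subset.chain ?A C"
    have CA: "left_ideal L \<and> 1 \<notin> L \<and> L0 \<subseteq> L" if "L \<in> C" for L
      using C(2) that unfolding subset_chain_def by blast
    have lin: "K \<subseteq> L \<or> L \<subseteq> K" if "K \<in> C" "L \<in> C" for K L
      using C(2) that unfolding subset_chain_def by blast
    obtain L1 where L1: "L1 \<in> C" using C(1) by blast
    have "left_ideal (\<Union>C)"
      unfolding left_ideal_def
    proof (intro conjI ballI allI)
      show "0 \<in> \<Union>C" using left_ideal_zero CA[OF L1] L1 by (meson UnionI)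
      show "r * a \<in> \<Union>C" if a: "a \<in> \<Union>C" for r a
      proof -
        obtain L where L: "L \<in> C" "a \<in> L" using a by blast
        then have "r * a \<in> L" using CA[OF L(1)] left_ideal_mult[of L a r] by blast
        then show ?thesis using L(1) by (rule UnionI[rotated])
      qed
      show "a + b \<in> \<Union>C" if a: "a \<in> \<Union>C" and b: "b \<in> \<Union>C" for a b
      proof -
        obtain K where K: "a \<in> K" "K \<in> C" using a by blast
        obtain L where L: "b \<in> L" "L \<in> C" using b by blast
        note KL = K L
        from lin[OF KL(2,4)] show ?thesis
        proof
          assume "K \<subseteq> L"
          then have "a + b \<in> L" using KL CA[OF KL(4)] left_ideal_add[of L a b] by blast
          then show ?thesis by (rule UnionI[rotated]) (rule KL)
        next
          assume "L \<subseteq> K"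
          then have "a + b \<in> K" using KL CA[OF KL(2)] left_ideal_add[of K a b] by blast
          then show ?thesis by (rule UnionI[rotated]) (rule KL)
        qed
      qed
    qed
    moreover have "1 \<notin> \<Union>C" using CA by (metis UnionE)
    moreover have "L0 \<subseteq> \<Union>C" using CA[OF L1] L1 by (metis Union_upper subset_trans)
    ultimately show "\<Union>C \<in> ?A" by simp
  qed
  then obtain L where L: "left_ideal L" "1 \<notin> L" "L0 \<subseteq> L"
    and mx: "\<And>K. left_ideal K \<Longrightarrow> 1 \<notin> K \<Longrightarrow> L \<subseteq> K \<Longrightarrow> K = L"
    by auto
  have "\<exists>r. 1 - r * a \<in> L" if a: "a \<notin> L" for a
  proof -
    let ?K = "{b. \<exists>r. b - r * a \<in> L}"
    have "left_ideal ?K"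
      unfolding left_ideal_def
    proof (intro conjI ballI allI)
      show "0 \<in> ?K" using left_ideal_zero[OF L(1)] by (auto intro!: exI[of _ 0])
      show "s * b \<in> ?K" if b: "b \<in> ?K" for s b
      proof -
        from b obtain r where "b - r * a \<in> L" by blast
        then have "s * b - (s * r) * a \<in> L"
          using left_ideal_mult[OF L(1), of _ s] by (fastforce simp: algebra_simps)
        then show ?thesis by blast
      qed
      show "b + c \<in> ?K" if bc: "b \<in> ?K" "c \<in> ?K" for b c
      proof -
        from bc obtain r s where "b - r * a \<in> L" "c - s * a \<in> L" by blast
        from left_ideal_add[OF L(1) this] have "b + c - (r + s) * a \<in> L"
          by (simp add: algebra_simps)
        then show ?thesis by blast
      qed
    qed
    moreover have "L \<subseteq> ?K" by (auto intro!: exI[of _ 0])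
    moreover have "a \<in> ?K" using left_ideal_zero[OF L(1)] by (auto intro!: exI[of _ 1])
    ultimately have "1 \<in> ?K" using mx[of ?K] a by blast
    then show ?thesis by blast
  qed
  with L show ?thesis by (intro that[of L]) (auto simp: max_left_ideal_def)
qed

text \<open>The core is a proper two-sided ideal above P, so maximality of P leaves no room. This is
  how a maximal ideal becomes primitive.\<close>

lemma core_eq_maximal:
  assumes L: "max_left_ideal L" and PL: "P \<subseteq> L" and P: "two_sided_ideal P"
    and mx: "\<And>J. two_sided_ideal J \<Longrightarrow> P \<subseteq> J \<Longrightarrow> 1 \<notin> J \<Longrightarrow> J = P"
  shows "core L = P"
  using mx[OF two_sided_ideal_core two_sided_ideal_subset_core[OF P PL]]
    max_left_idealD(1,2)[OF L] core_subset by blast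

text \<open>For finite S, equality with \<open>UNIV\<close> says that R / N is finitely generated
  over Z. Any set Z is allowed because the uses differ: the centre modulo the core, the whole ring,
  or just the scalars.\<close>

inductive_set comb :: "'r::ring_1 set \<Rightarrow> 'r set \<Rightarrow> 'r set \<Rightarrow> 'r set" for Z S N where
  comb_base: "a \<in> N \<Longrightarrow> a \<in> comb Z S N"
| comb_gen: "z \<in> Z \<Longrightarrow> s \<in> S \<Longrightarrow> z * s \<in> comb Z S N"
| comb_add: "a \<in> comb Z S N \<Longrightarrow> b \<in> comb Z S N \<Longrightarrow> a + b \<in> comb Z S N"

text \<open>As in the density theorem, \<open>e\<close> is built one element of \<open>S\<close> at a time; if the next element
  \<open>t\<close> cannot be adjusted independently, then \<open>J (1 - e) t = 0\<close> in \<open>R / L\<close>, hence \<open>e t = t\<close>.\<close>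

lemma local_unit:
  assumes L: "max_left_ideal L" and J: "two_sided_ideal J" and nJ: "\<not> J \<subseteq> core L" and S: "finite S"
  shows "\<exists>e\<in>J. \<forall>s\<in>S. e * s - s \<in> L"
  using S
proof (induction S)
  case empty
  then show ?case using left_ideal_zero[OF two_sided_idealD[OF J]] by blast
next
  case (insert t S)
  note Ll = max_left_idealD(1)[OF L] and Jl = two_sided_idealD[OF J]
  \<comment> \<open>If J kills r modulo L and r is not in L, then R r + L is everything, so J would
    kill R / L and lie in the core.\<close>
  have faithful: "r \<in> L" if r: "\<And>j. j \<in> J \<Longrightarrow> j * r \<in> L" for r
  proof (rule ccontr)
    assume "r \<notin> L"
    then obtain s where s: "1 - s * r \<in> L" using max_left_idealD(3)[OF L] by blast
    obtain j u where ju: "j \<in> J" "j * u \<notin> L" using nJ by (auto simp: core_def)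
    have "j * u * (1 - s * r) \<in> L" using left_ideal_mult[OF Ll s] .
    moreover have "j * u * s * r \<in> L"
      by (intro r two_sided_ideal_mult_right[OF J]) (rule ju)
    ultimately have "j * u * (1 - s * r) + j * u * s * r \<in> L" by (rule left_ideal_add[OF Ll])
    then show False using ju(2) by (simp add: algebra_simps)
  qed
  obtain e where e: "e \<in> J" "\<And>s. s \<in> S \<Longrightarrow> e * s - s \<in> L" using insert by blast
  show ?case
  proof (cases "\<exists>a\<in>J. (\<forall>s\<in>S. a * s \<in> L) \<and> a * t \<notin> L")
    case True
    then obtain a where a: "a \<in> J" "\<And>s. s \<in> S \<Longrightarrow> a * s \<in> L" "a * t \<notin> L" by blast
    obtain r where r: "1 - r * (a * t) \<in> L" using max_left_idealD(3)[OF L a(3)] ..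
    \<comment> \<open>The element r a sends t to 1 in R / L and kills S, so the correction repairs e
      at t and leaves its effect on S alone.\<close>
    let ?e = "e + (t - e * t) * (r * a)"
    have "?e \<in> J"
      by (intro left_ideal_add[OF Jl] left_ideal_mult[OF Jl] a e)
    moreover have "?e * s - s \<in> L" if "s \<in> S" for s
    proof -
      have "?e * s - s = (e * s - s) + (t - e * t) * r * (a * s)" by (simp add: algebra_simps)
      then show ?thesis
        using left_ideal_add[OF Ll e(2)[OF that] left_ideal_mult[OF Ll a(2)[OF that]]] by metis
    qed
    moreover have "?e * t - t \<in> L"
    proof -
      have "?e * t - t = (e * t - t) * (1 - r * (a * t))" by (simp add: algebra_simps)
      then show ?thesis using left_ideal_mult[OF Ll r] by metis
    qed
    ultimately show ?thesis by blast
  next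
    case False
    have "e * t - t \<in> L"
    proof (rule faithful)
      fix j assume j: "j \<in> J"
      let ?a = "j * e - j"
      have "?a \<in> J" using left_ideal_diff[OF Jl two_sided_ideal_mult_right[OF J j] j] .
      moreover have "?a * s \<in> L" if "s \<in> S" for s
        using left_ideal_mult[OF Ll e(2)[OF that], of j] by (simp add: algebra_simps)
      ultimately have "?a * t \<in> L" using False by blast
      then show "j * (e * t - t) \<in> L" by (simp add: algebra_simps)
    qed
    then show ?thesis using e by blast
  qed
qed

lemma core_maximal:
  assumes L: "max_left_ideal L" and S: "finite S"
    and Z: "\<And>z r. z \<in> Z \<Longrightarrow> z * r - r * z \<in> core L"
    and gen: "comb Z S (core L) = UNIV"
    and J: "two_sided_ideal J" "core L \<subseteq> J" "J \<noteq> core L"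
  shows "1 \<in> J"
proof -
  note Ll = max_left_idealD(1)[OF L] 
  obtain e where e: "e \<in> J" "\<And>s. s \<in> S \<Longrightarrow> e * s - s \<in> L"
    using local_unit[OF L J(1) _ S] J(2,3) by blast
  have "e * r - r \<in> L" if "r \<in> comb Z S (core L)" for r
    using that
  proof induction
    case (comb_base a)
    then have "a \<in> L" using core_subset by blast
    then show ?case by (intro left_ideal_diff[OF Ll] left_ideal_mult[OF Ll])
  next
    case (comb_gen z s)
    \<comment> \<open>Modulo the core z passes e, so e fixes z s as soon as it fixes s.\<close>
    have "(z * e - e * z) * s \<in> L" using Z[OF comb_gen(1), of e] unfolding core_def by blast
    moreover have "z * (e * s - s) \<in> L" using left_ideal_mult[OF Ll e(2)[OF comb_gen(2)]] .
    ultimately have "z * (e * s - s) - (z * e - e * z) * s \<in> L" by (intro left_ideal_diff[OF Ll])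
    then show ?case by (simp add: algebra_simps)
  next
    case (comb_add a b)
    from left_ideal_add[OF Ll comb_add(3,4)] show ?case by (simp add: algebra_simps)
  qed
  then have "e - 1 \<in> core L" unfolding gen by (simp add: core_def algebra_simps)
  then have "e - (e - 1) \<in> J"
    using J(2) e(1) left_ideal_diff[OF two_sided_idealD[OF J(1)]] by blast
  then show ?thesis by simp
qed

section \<open>Left ideals and modules over a quotient\<close>

text \<open>The source of \<open>q\<close> is a whole type, so that calculations in \<open>A\<close> can be done
  with type-class arithmetic modulo an ideal.\<close>

locale type_quotient = A?: ring A for A :: "('a, 'b) ring_scheme" (structure) +
  fixes q :: "'r::ring_1 \<Rightarrow> 'a"
  assumes carrier_eq: "carrier A = range q"
    and q_add: "q (a + b) = q a \<oplus> q b"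
    and q_mult: "q (a * b) = q a \<otimes> q b"
    and q_one: "q 1 = \<one>"
begin

lemma q_closed [simp]: "q a \<in> carrier A"
  by (simp add: carrier_eq)

lemma q_zero: "q 0 = \<zero>"
  using q_add[of 0 0] by (simp add: A.add.l_cancel_one)

lemma q_uminus: "q (- a) = \<ominus> q a"
  using q_add[of "- a" a] by (simp add: q_zero A.minus_equality)

section \<open>Ideals of A and ideals above the kernel\<close>

definition ker :: "'r set" where "ker = {a. q a = \<zero>}"

lemma two_sided_ideal_ker: "two_sided_ideal ker"
  by (simp add: two_sided_ideal_def left_ideal_def ker_def q_zero q_add q_mult)

lemma q_eq_iff: "q a = q b \<longleftrightarrow> a - b \<in> ker"
proof
  assume "q a = q b"
  then show "a - b \<in> ker"
    using q_add[of a "- b"] by (simp add: ker_def q_uminus A.r_neg)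
next
  assume "a - b \<in> ker"
  then show "q a = q b"
    using q_add[of "a - b" b] by (simp add: ker_def)
qed

lemma q_vimage_ker:
  assumes "ideal P A" shows "ker \<subseteq> q -` P"
proof -
  interpret ideal P A by fact
  show ?thesis using zero_closed by (auto simp: ker_def)
qed

lemma two_sided_ideal_vimage:
  assumes "ideal P A" shows "two_sided_ideal (q -` P)"
proof -
  interpret ideal P A by fact
  show ?thesis
    using zero_closed a_closed I_l_closed I_r_closed
    by (auto simp: two_sided_ideal_def left_ideal_def q_zero q_add q_mult)
qed

lemma ideal_image:
  assumes "two_sided_ideal J" shows "ideal (q ` J) A"
proof (rule idealI)
  note Jl = two_sided_idealD[OF assms]
  show "ring A" by (rule A.ring_axioms)
  show "subgroup (q ` J) (add_monoid A)"
  proof (rule A.add.subgroupI)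
    show "q ` J \<subseteq> carrier A" by auto
    show "q ` J \<noteq> {}" using left_ideal_zero[OF Jl] by blast
    show "\<ominus> a \<in> q ` J" if "a \<in> q ` J" for a
      using that left_ideal_uminus[OF Jl] by (auto simp flip: q_uminus)
    show "a \<oplus> b \<in> q ` J" if "a \<in> q ` J" "b \<in> q ` J" for a b
      using that left_ideal_add[OF Jl] by (auto simp flip: q_add)
  qed
  show "x \<otimes> a \<in> q ` J" if "a \<in> q ` J" "x \<in> carrier A" for a x
    using that left_ideal_mult[OF Jl] by (auto simp: carrier_eq simp flip: q_mult)
  show "a \<otimes> x \<in> q ` J" if "a \<in> q ` J" "x \<in> carrier A" for a x
    using that two_sided_ideal_mult_right[OF assms] by (auto simp: carrier_eq simp flip: q_mult)
qed

lemma vimage_image: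
  assumes "left_ideal J" "ker \<subseteq> J" shows "q -` (q ` J) = J"
proof -
  have "b \<in> J" if "q b = q a" "a \<in> J" for a b
    using that assms left_ideal_diff_iff[of J b a] by (auto simp: q_eq_iff)
  then show ?thesis by auto
qed

lemma image_vimage: "P \<subseteq> carrier A \<Longrightarrow> q ` (q -` P) = P"
  by (auto simp: carrier_eq)

lemma ideal_subset_carrier: "ideal P A \<Longrightarrow> P \<subseteq> carrier A"
  by (rule additive_subgroup.a_subset[OF ideal.axioms(1)])

text \<open>Ideals of A correspond to two-sided ideals of the source above the kernel. The condition
  that 1 lies in every larger J is the form in which \<open>core_maximal\<close> delivers
  maximality.\<close>

lemma maximalideal_iff:
  assumes P: "ideal P A"
  shows "maximalideal P A \<longleftrightarrow> 1 \<notin> q -` P \<and>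
    (\<forall>J. two_sided_ideal J \<and> q -` P \<subseteq> J \<and> J \<noteq> q -` P \<longrightarrow> 1 \<in> J)" (is "?L \<longleftrightarrow> ?R")
proof
  assume ?L
  then interpret maximalideal P A .
  have "1 \<notin> q -` P" using I_notcarr one_imp_carrier by (auto simp: q_one)
  moreover have "1 \<in> J" if J: "two_sided_ideal J" "q -` P \<subseteq> J" "J \<noteq> q -` P" for J
  proof -
    have k: "q -` (q ` J) = J"
      using vimage_image two_sided_idealD J(1,2) q_vimage_ker[OF P] by blast
    have "P \<subseteq> q ` J" using image_vimage[OF ideal_subset_carrier[OF P]] J(2) by blast
    then have "q ` J = P \<or> q ` J = carrier A"
      using ideal_image[OF J(1)] by (intro I_maximal) auto
    with k J(3) have "q ` J = carrier A" by auto
    then have "q 1 \<in> q ` J" by simp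
    with k show ?thesis by blast
  qed
  ultimately show ?R by blast
next
  assume R: ?R
  show ?L
  proof (intro maximalideal.intro maximalideal_axioms.intro P)
    show "carrier A \<noteq> P" using R q_closed[of 1] by auto
    fix K assume K: "ideal K A" "P \<subseteq> K" "K \<subseteq> carrier A"
    show "K = P \<or> K = carrier A"
    proof (cases "q -` K = q -` P")
      case True
      then show ?thesis using image_vimage K(3) ideal_subset_carrier[OF P] by metis
    next
      case False
      then have "1 \<in> q -` K" using R two_sided_ideal_vimage[OF K(1)] K(2) by blast
      then show ?thesis using ideal.one_imp_carrier[OF K(1)] by (auto simp: q_one)
    qed
  qed
qed

text \<open>A nonzero v generates M, so M is R / L for the annihilator L of v. Elementwise
  maximality of L says that every nonzero a v generates v again.\<close>

lemma irreducible_module_max_left_ideal: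
  fixes M :: "('a, 'm, 'z) module_scheme"
  assumes irr: "irreducible_module A M"
  obtains v where "v \<in> carrier M" "max_left_ideal {a. q a \<odot>\<^bsub>M\<^esub> v = \<zero>\<^bsub>M\<^esub>}"
    "ker \<subseteq> {a. q a \<odot>\<^bsub>M\<^esub> v = \<zero>\<^bsub>M\<^esub>}" "carrier M = range (\<lambda>a. q a \<odot>\<^bsub>M\<^esub> v)"
    "q -` annihilator A M = core {a. q a \<odot>\<^bsub>M\<^esub> v = \<zero>\<^bsub>M\<^esub>}"
proof -
  interpret left_module A M using irr by (simp add: irreducible_module_def)
  note [simp] = smult_closed
  have simple: "N = {\<zero>\<^bsub>M\<^esub>} \<or> N = carrier M" if "submodule N A M" for N
    using irr that by (simp add: irreducible_module_def)
  obtain v where v: "v \<in> carrier M" "v \<noteq> \<zero>\<^bsub>M\<^esub>"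
    using irr M.zero_closed by (auto simp: irreducible_module_def)
  let ?L = "{a. q a \<odot>\<^bsub>M\<^esub> v = \<zero>\<^bsub>M\<^esub>}"
  have gen: "range (\<lambda>a. q a \<odot>\<^bsub>M\<^esub> w) = carrier M" if w: "w \<in> carrier M" "w \<noteq> \<zero>\<^bsub>M\<^esub>" for w
  proof -
    have "submodule (range (\<lambda>a. q a \<odot>\<^bsub>M\<^esub> w)) A M"
      unfolding submodule_iff[OF left_module_axioms]
    proof (intro conjI ballI)
      show "range (\<lambda>a. q a \<odot>\<^bsub>M\<^esub> w) \<subseteq> carrier M" using w by auto
      show "\<zero>\<^bsub>M\<^esub> \<in> range (\<lambda>a. q a \<odot>\<^bsub>M\<^esub> w)"
        by (rule range_eqI[of _ _ 0]) (simp add: q_zero smult_zero_left w)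
      show "x \<oplus>\<^bsub>M\<^esub> y \<in> range (\<lambda>a. q a \<odot>\<^bsub>M\<^esub> w)"
        if "x \<in> range (\<lambda>a. q a \<odot>\<^bsub>M\<^esub> w)" "y \<in> range (\<lambda>a. q a \<odot>\<^bsub>M\<^esub> w)" for x y
      proof -
        from that obtain a b where "x = q a \<odot>\<^bsub>M\<^esub> w" "y = q b \<odot>\<^bsub>M\<^esub> w" by blast
        then show ?thesis
          by (intro range_eqI[of _ _ "a + b"]) (simp add: q_add smult_l_distr w)
      qed
      show "c \<odot>\<^bsub>M\<^esub> x \<in> range (\<lambda>a. q a \<odot>\<^bsub>M\<^esub> w)"
        if "c \<in> carrier A" "x \<in> range (\<lambda>a. q a \<odot>\<^bsub>M\<^esub> w)" for c x
      proof -
        from that obtain a b where "c = q b" "x = q a \<odot>\<^bsub>M\<^esub> w" by (auto simp: carrier_eq)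
        then show ?thesis
          by (intro range_eqI[of _ _ "b * a"]) (simp add: q_mult smult_assoc1 w)
      qed
    qed
    from simple[OF this] show ?thesis
    proof
      assume *: "range (\<lambda>a. q a \<odot>\<^bsub>M\<^esub> w) = {\<zero>\<^bsub>M\<^esub>}"
      have "q 1 \<odot>\<^bsub>M\<^esub> w \<in> range (\<lambda>a. q a \<odot>\<^bsub>M\<^esub> w)" by (rule rangeI)
      then have "w = \<zero>\<^bsub>M\<^esub>" unfolding * by (simp add: q_one smult_one w)
      with w show ?thesis by simp
    qed
  qed
  have "left_ideal ?L"
    by (simp add: left_ideal_def q_zero q_add q_mult smult_zero_left smult_l_distr smult_assoc1
        smult_zero_right v)
  moreover have "1 \<notin> ?L" using v by (simp add: q_one smult_one)
  moreover have "\<exists>r. 1 - r * a \<in> ?L" if "a \<notin> ?L" for a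
  proof -
    have "v \<in> range (\<lambda>r. q r \<odot>\<^bsub>M\<^esub> (q a \<odot>\<^bsub>M\<^esub> v))"
      using gen[of "q a \<odot>\<^bsub>M\<^esub> v"] that v by simp
    then obtain r where r: "v = q r \<odot>\<^bsub>M\<^esub> (q a \<odot>\<^bsub>M\<^esub> v)" by blast
    have "q (1 - r * a) \<odot>\<^bsub>M\<^esub> v = v \<oplus>\<^bsub>M\<^esub> \<ominus>\<^bsub>M\<^esub> (q r \<odot>\<^bsub>M\<^esub> (q a \<odot>\<^bsub>M\<^esub> v))"
      using v(1) q_add[of 1 "- (r * a)"] q_closed[of "r * a"] q_closed[of 1]
      by (simp add: q_uminus smult_l_distr smult_minus_left smult_one q_one)
        (simp add: q_mult smult_assoc1)
    also have "\<dots> = \<zero>\<^bsub>M\<^esub>" using r v(1) M.r_neg by metis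
    finally show ?thesis by blast
  qed
  ultimately have L: "max_left_ideal ?L" unfolding max_left_ideal_def by blast
  have k: "ker \<subseteq> ?L" using v by (auto simp: ker_def smult_zero_left)
  have "q a \<in> annihilator A M \<longleftrightarrow> a \<in> core ?L" for a
  proof -
    have "q a \<in> annihilator A M \<longleftrightarrow> (\<forall>r. q a \<odot>\<^bsub>M\<^esub> (q r \<odot>\<^bsub>M\<^esub> v) = \<zero>\<^bsub>M\<^esub>)"
      unfolding annihilator_def gen[OF v, symmetric] by auto
    then show ?thesis by (simp add: core_def q_mult smult_assoc1 v)
  qed
  then have "q -` annihilator A M = core ?L" by auto
  with that[OF v(1) L k] gen[OF v] show ?thesis by metis
qed

text \<open>The module is R / L, with the cosets \<open>k a\<close> as elements. Its operations go
  through representatives chosen by \<open>inv_into\<close>, which are determined only up to L and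
  up to the kernel.\<close>

lemma max_left_ideal_primitive:
  assumes L: "max_left_ideal L" "ker \<subseteq> L"
  shows "primitive_ideal A (q ` core L)"
proof -
  note Ll = max_left_idealD(1)[OF L(1)]
  define k where "k a = {b. b - a \<in> L}" for a
  have k_iff: "k a = k b \<longleftrightarrow> a - b \<in> L" for a b
  proof
    assume "k a = k b"
    then have "a \<in> k b" using left_ideal_zero[OF Ll] by (auto simp: k_def)
    then show "a - b \<in> L" by (simp add: k_def)
  next
    assume ab: "a - b \<in> L"
    have "c - a \<in> L \<longleftrightarrow> c - b \<in> L" for c
      using left_ideal_diff_iff[OF Ll, of "c - b" "c - a"] ab by (simp add: algebra_simps)
    then show "k a = k b" by (simp add: k_def)
  qed
  define M :: "('a, 'r set) module" where
    "M = \<lparr>carrier = range k, monoid.mult = undefined, one = undefined, ring.zero = k 0,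
       add = (\<lambda>C D. k (inv_into UNIV k C + inv_into UNIV k D)), module.smult = (\<lambda>a C. k (inv_into UNIV q a * inv_into UNIV k C))\<rparr>"
  have kk: "inv_into UNIV k (k a) - a \<in> L" for a
    using f_inv_into_f[OF rangeI, of k a] by (simp add: k_iff)
  have qq: "inv_into UNIV q (q a) - a \<in> L" for a
    using f_inv_into_f[OF rangeI, of q a] L(2) by (auto simp: q_eq_iff)
  have [simp]: "carrier M = range k" "\<zero>\<^bsub>M\<^esub> = k 0"
    by (simp_all add: M_def)
  have [simp]: "k a \<oplus>\<^bsub>M\<^esub> k b = k (a + b)" for a b
    using left_ideal_add[OF Ll kk[of a] kk[of b]] by (simp add: M_def k_iff algebra_simps)
  have [simp]: "q a \<odot>\<^bsub>M\<^esub> k b = k (a * b)" for a b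
  proof -
    \<comment> \<open>The kernel is two-sided, so the error in the representative of the scalar
      stays in L after right multiplication by b.\<close>
    have "inv_into UNIV q (q a) - a \<in> ker"
      using f_inv_into_f[OF rangeI, of q a] by (auto simp: q_eq_iff)
    then have "(inv_into UNIV q (q a) - a) * b \<in> L"
      using two_sided_ideal_mult_right[OF two_sided_ideal_ker] L(2) by blast
    from left_ideal_add[OF Ll this left_ideal_mult[OF Ll kk[of b], of "inv_into UNIV q (q a)"]]
    show ?thesis by (simp add: M_def k_iff algebra_simps)
  qed
  have "abelian_group M"
  proof (rule abelian_groupI)
    fix C assume "C \<in> carrier M"
    then obtain c where "C = k c" by auto
    then show "\<exists>D\<in>carrier M. D \<oplus>\<^bsub>M\<^esub> C = \<zero>\<^bsub>M\<^esub>"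
      by (auto intro!: exI[of _ "- c"])
  qed (auto simp: algebra_simps)
  then have lm: "left_module A M"
    by (intro left_module.intro left_module_axioms.intro A.ring_axioms)
      (auto simp: carrier_eq distrib_left distrib_right mult.assoc simp flip: q_add q_mult q_one)
  have "N = {\<zero>\<^bsub>M\<^esub>} \<or> N = carrier M" if N: "submodule N A M" for N
  proof (cases "N \<subseteq> {k 0}")
    case True
    then show ?thesis using N by (auto simp: submodule_iff[OF lm])
  next
    case False
    then obtain C where C: "C \<in> N" "C \<noteq> k 0" by blast
    then obtain a where "C = k a" using N by (auto simp: submodule_iff[OF lm])
    with C have a: "k a \<in> N" "a \<notin> L" by (simp_all add: k_iff)
    obtain r where r: "1 - r * a \<in> L" using max_left_idealD(3)[OF L(1) a(2)] ..
    have sm: "q s \<odot>\<^bsub>M\<^esub> C \<in> N" if "C \<in> N" for s C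
      using N that by (simp add: submodule_iff[OF lm])
    have "k 1 = k (r * a)" using r by (simp add: k_iff)
    then have "k 1 \<in> N" using sm[OF a(1), of r] by simp
    then have "k s \<in> N" for s using sm[of "k 1" s] by simp
    then show ?thesis using N by (auto simp: submodule_iff[OF lm])
  qed
  moreover have "carrier M \<noteq> {\<zero>\<^bsub>M\<^esub>}"
  proof
    assume "carrier M = {\<zero>\<^bsub>M\<^esub>}"
    then have "k 1 = k 0" by (metis \<open>carrier M = range k\<close> \<open>\<zero>\<^bsub>M\<^esub> = k 0\<close> rangeI singletonD)
    then show False using max_left_idealD(2)[OF L(1)] by (simp add: k_iff)
  qed
  ultimately have "irreducible_module A M" using lm by (simp add: irreducible_module_def)
  moreover have "annihilator A M = q ` core L"
  proof -
    have "q a \<in> annihilator A M \<longleftrightarrow> a \<in> core L" for a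
      by (simp add: annihilator_def core_def k_iff)
    moreover have "annihilator A M \<subseteq> range q"
      by (auto simp: annihilator_def carrier_eq)
    ultimately show ?thesis by blast
  qed
  ultimately show ?thesis using primitive_ideal_annihilator by metis
qed

lemma primitive_ideal_iff:
  assumes P: "ideal P A"
  shows "primitive_ideal A P \<longleftrightarrow> (\<exists>L. max_left_ideal L \<and> ker \<subseteq> L \<and> q -` P = core L)"
proof
  assume "primitive_ideal A P"
  then show "\<exists>L. max_left_ideal L \<and> ker \<subseteq> L \<and> q -` P = core L"
    unfolding primitive_ideal_def by (metis irreducible_module_max_left_ideal)
next
  assume "\<exists>L. max_left_ideal L \<and> ker \<subseteq> L \<and> q -` P = core L"
  then show "primitive_ideal A P"
    using max_left_ideal_primitive image_vimage[OF ideal_subset_carrier[OF P]] by metis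
qed

lemma maximalideal_primitive:
  assumes P: "maximalideal P A"
  shows "primitive_ideal A P"
proof -
  have i: "ideal P A" using P by (rule maximalideal.axioms)
  note m = P[unfolded maximalideal_iff[OF i]]
  note t = two_sided_ideal_vimage[OF i]
  obtain L where L: "max_left_ideal L" "q -` P \<subseteq> L"
    using exists_max_left_ideal[OF two_sided_idealD[OF t]] m by blast
  have "core L = q -` P" using core_eq_maximal[OF L t] m by blast
  then show ?thesis using primitive_ideal_iff[OF i] L q_vimage_ker[OF i] by blast
qed

end

section \<open>The polynomial subalgebra and a right module over \<open>Ah\<close>\<close>

text \<open>The zero map is a monomial with coefficient 0, hence only two cases.\<close>

lemma poly_mapping_add_induct [case_names single add]:
  fixes p :: "'a \<Rightarrow>\<^sub>0 'b::comm_monoid_add"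
  assumes "\<And>k v. P (Poly_Mapping.single k v)" "\<And>p q. P p \<Longrightarrow> P q \<Longrightarrow> P (p + q)"
  shows "P p"
proof (induction p rule: update_induct)
  case const
  show ?case using assms(1)[of undefined 0] by simp
next
  case (update p k v)
  have "Poly_Mapping.update k v p = Poly_Mapping.single k v + p"
    using update(1)
    by (intro poly_mapping_eqI) (auto simp: lookup_update lookup_add lookup_single in_keys_iff when_def)
  then show ?case using assms update by metis
qed

abbreviation gX :: "'f::field free_algebra" where "gX \<equiv> free_gen GenX"
abbreviation gY :: "'f::field free_algebra" where "gY \<equiv> free_gen GenY"

lemma free_const_zero [simp]: "free_const 0 = 0"
  and free_const_one [simp]: "free_const 1 = 1"
  and free_const_add: "free_const (a + b) = free_const a + free_const b"
  and free_const_mult: "free_const (a * b) = free_const a * free_const b"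
  by (simp_all add: free_const_def single_add mult_single)

lemma free_const_of_nat: "free_const (of_nat n) = of_nat n"
  by (induction n) (simp_all add: free_const_add)

lemma free_const_commute: "free_const c * r = r * free_const c"
proof (induction r rule: poly_mapping_add_induct)
  case (single k v)
  then show ?case by (simp add: free_const_def mult_single mult.commute)
qed (simp add: distrib_left distrib_right)

lemma free_const_left_commute: "free_const c * (a * r) = a * (free_const c * r)"
  by (simp only: mult.assoc[symmetric] free_const_commute[of c a])

lemma free_algebra_induct [case_names one add const X Y]:
  fixes r :: "'f::field free_algebra"
  assumes one: "P 1" and add: "\<And>a b. P a \<Longrightarrow> P b \<Longrightarrow> P (a + b)"
    and const: "\<And>c a. P a \<Longrightarrow> P (free_const c * a)"
    and X: "\<And>a. P a \<Longrightarrow> P (gX * a)" and Y: "\<And>a. P a \<Longrightarrow> P (gY * a)"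
  shows "P r"
proof (induction r rule: poly_mapping_add_induct)
  case (single w c)
  have "P (Poly_Mapping.single (Word gs) 1)" for gs
  proof (induction gs)
    case Nil
    then show ?case using one by (simp flip: zero_gen_word_def)
  next
    case (Cons g gs)
    have "Poly_Mapping.single (Word (g # gs)) (1::'f) = free_gen g * Poly_Mapping.single (Word gs) 1"
      by (simp add: free_gen_def mult_single plus_gen_word_def)
    then show ?case using Cons X Y by (cases g) auto
  qed
  then have "P (free_const c * Poly_Mapping.single w 1)" using const by (cases w) auto
  then show ?case by (simp add: free_const_def mult_single)
qed (rule add)

section \<open>Polynomials in x inside the free algebra\<close>

definition fpoly :: "'f::field poly \<Rightarrow> 'f free_algebra" where
  "fpoly p = (\<Sum>i\<le>Polynomial.degree p. free_const (Polynomial.coeff p i) * gX ^ i)"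

lemma fpoly_altdef:
  assumes "Polynomial.degree p \<le> n"
  shows "fpoly p = (\<Sum>i\<le>n. free_const (Polynomial.coeff p i) * gX ^ i)"
  unfolding fpoly_def
  using assms by (intro sum.mono_neutral_left) (auto simp: Polynomial.coeff_eq_0)

lemma fpoly_zero [simp]: "fpoly 0 = 0"
  by (simp add: fpoly_def)

lemma fpoly_add: "fpoly (p + q) = fpoly p + fpoly q"
proof -
  let ?n = "max (Polynomial.degree p) (Polynomial.degree q)"
  have "Polynomial.degree (p + q) \<le> ?n" by (rule Polynomial.degree_add_le_max)
  then show ?thesis
    by (simp add: fpoly_altdef[of _ ?n] free_const_add distrib_right sum.distrib)
qed

lemma fpoly_uminus: "fpoly (- p) = - fpoly p"
  using fpoly_add[of p "- p"] by (simp add: eq_neg_iff_add_eq_0 add.commute)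

lemma fpoly_diff: "fpoly (p - q) = fpoly p - fpoly q"
  using fpoly_add[of p "- q"] by (simp add: fpoly_uminus)

lemma fpoly_smult: "fpoly (Polynomial.smult c p) = free_const c * fpoly p"
proof -
  have "Polynomial.degree (Polynomial.smult c p) \<le> Polynomial.degree p" by simp
  then show ?thesis
    by (simp only: fpoly_altdef[of _ "Polynomial.degree p"])
      (simp add: free_const_mult sum_distrib_left mult.assoc)
qed

lemma fpoly_pCons: "fpoly (pCons a p) = free_const a + gX * fpoly p"
proof -
  have "Polynomial.degree (pCons a p) \<le> Suc (Polynomial.degree p)" by (rule degree_pCons_le)
  then have "fpoly (pCons a p) =
      free_const a + (\<Sum>i\<le>Polynomial.degree p. free_const (Polynomial.coeff p i) * gX ^ Suc i)"
    unfolding fpoly_altdef[OF \<open>_ \<le> _\<close>] sum.atMost_Suc_shift by simp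
  also have "(\<Sum>i\<le>Polynomial.degree p. free_const (Polynomial.coeff p i) * gX ^ Suc i) = gX * fpoly p"
    unfolding fpoly_def sum_distrib_left
    by (simp add: free_const_left_commute)
  finally show ?thesis .
qed

lemma fpoly_const: "fpoly [:a:] = free_const a"
  by (simp add: fpoly_pCons)

lemma fpoly_one [simp]: "fpoly 1 = 1"
  by (simp add: one_pCons fpoly_const)

lemma fpoly_mult: "fpoly (p * q) = fpoly p * fpoly q"
  by (induction p) (simp_all add: fpoly_pCons fpoly_add fpoly_smult distrib_right mult.assoc)

lemma fpoly_power: "fpoly (p ^ n) = fpoly p ^ n"
  by (induction n) (simp_all add: fpoly_mult)

lemma fpoly_x: "fpoly [:0, 1:] = gX"
  by (simp add: fpoly_pCons)

lemma fpoly_commute: "fpoly p * fpoly q = fpoly q * fpoly p"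
  by (metis fpoly_mult mult.commute)

lemma fpoly_commute_X: "fpoly p * gX = gX * fpoly p"
  using fpoly_commute[of p "[:0, 1:]"] by (simp only: fpoly_x)

lemma Ah_relator_eq: "Ah_relator h = gY * gX - gX * gY - fpoly h"
  by (simp add: Ah_relator_def fpoly_def)

text \<open>The right module \<open>F[x]\<close> with \<open>f . x = x f\<close> and \<open>f . y = - h f'\<close>. Since \<open>f . (a g) = g (f . a)\<close>
  for a polynomial \<open>g\<close>, it shows that non-constant polynomials have no left inverse in \<open>Ah\<close>.\<close>

primrec gen_op :: "'f::field poly \<Rightarrow> generator \<Rightarrow> 'f poly \<Rightarrow> 'f poly" where
  "gen_op h GenX f = [:0, 1:] * f"
| "gen_op h GenY f = - (h * pderiv f)"

definition word_op :: "'f::field poly \<Rightarrow> gen_word \<Rightarrow> 'f poly \<Rightarrow> 'f poly" where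
  "word_op h w = fold (gen_op h) (letters w)"

definition right_op :: "'f::field poly \<Rightarrow> 'f free_algebra \<Rightarrow> 'f poly \<Rightarrow> 'f poly" where
  "right_op h a f = (\<Sum>w\<in>Poly_Mapping.keys a. Polynomial.smult (Poly_Mapping.lookup a w) (word_op h w f))"

lemma word_op_add: "word_op h w (f + g) = word_op h w f + word_op h w g"
proof -
  have "fold (gen_op h) gs (f + g) = fold (gen_op h) gs f + fold (gen_op h) gs g" for gs
  proof (induction gs arbitrary: f g)
    case (Cons a gs)
    have "gen_op h a (f + g) = gen_op h a f + gen_op h a g"
      by (cases a) (simp_all only: gen_op.simps pderiv_add distrib_left minus_add_distrib)
    then show ?case by (simp add: Cons)
  qed simp
  then show ?thesis by (simp add: word_op_def)
qed

lemma word_op_smult: "word_op h w (Polynomial.smult c f) = Polynomial.smult c (word_op h w f)"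
proof -
  have "fold (gen_op h) gs (Polynomial.smult c f) = Polynomial.smult c (fold (gen_op h) gs f)" for gs
  proof (induction gs arbitrary: f)
    case (Cons a gs)
    have "gen_op h a (Polynomial.smult c f) = Polynomial.smult c (gen_op h a f)"
      by (cases a) (simp_all add: pderiv_smult)
    then show ?case by (simp add: Cons)
  qed simp
  then show ?thesis by (simp add: word_op_def)
qed

lemma word_op_plus: "word_op h (v + w) f = word_op h w (word_op h v f)"
  by (simp add: word_op_def plus_gen_word_def)

lemma right_op_altdef:
  assumes "finite A" "Poly_Mapping.keys a \<subseteq> A"
  shows "right_op h a f = (\<Sum>w\<in>A. Polynomial.smult (Poly_Mapping.lookup a w) (word_op h w f))"
  unfolding right_op_def
  using assms by (intro sum.mono_neutral_left) (auto simp: in_keys_iff)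

lemma right_op_add_left: "right_op h (a + b) f = right_op h a f + right_op h b f"
  using keys_add[of a b]
  by (simp add: right_op_altdef[of "Poly_Mapping.keys a \<union> Poly_Mapping.keys b"]
      lookup_add smult_add_left sum.distrib)

lemma right_op_single: "right_op h (Poly_Mapping.single w c) f = Polynomial.smult c (word_op h w f)"
  using right_op_altdef[of "{w}" "Poly_Mapping.single w c" h f] by simp

lemma right_op_add_right: "right_op h a (f + g) = right_op h a f + right_op h a g"
  by (simp add: right_op_def word_op_add smult_add_right sum.distrib)

lemma right_op_zero_left: "right_op h 0 f = 0"
  by (simp add: right_op_def)

lemma right_op_zero_right: "right_op h a 0 = 0"
  using right_op_add_right[of h a 0 0] by (metis add.right_neutral add_cancel_left_right)

lemma right_op_uminus: "right_op h (- a) f = - right_op h a f"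
  using right_op_add_left[of h a "- a" f]
  by (simp add: right_op_zero_left eq_neg_iff_add_eq_0 add.commute)

lemma right_op_diff: "right_op h (a - b) f = right_op h a f - right_op h b f"
  using right_op_add_left[of h a "- b" f] by (simp add: right_op_uminus)

lemma right_op_mult: "right_op h (a * b) f = right_op h b (right_op h a f)"
proof (induction a rule: poly_mapping_add_induct)
  case (single v c)
  show ?case
  proof (induction b rule: poly_mapping_add_induct)
    case (single w d)
    then show ?case
      by (simp add: mult_single right_op_single word_op_plus word_op_smult mult.commute)
  qed (simp add: distrib_left right_op_add_left)
qed (simp add: distrib_right right_op_add_left right_op_add_right)

lemma right_op_X: "right_op h gX f = [:0, 1:] * f"
  and right_op_Y: "right_op h gY f = - (h * pderiv f)"
  by (simp_all add: free_gen_def right_op_single word_op_def)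

lemma right_op_const: "right_op h (free_const c) f = Polynomial.smult c f"
  by (simp add: free_const_def right_op_single word_op_def zero_gen_word_def)

lemma right_op_fpoly: "right_op h (fpoly p) f = p * f"
proof (induction p arbitrary: f)
  case (pCons a p)
  then show ?case
    by (simp add: fpoly_pCons right_op_add_left right_op_mult right_op_const right_op_X)
qed (simp add: right_op_zero_left)

text \<open>In a right module y x acts by y first. By the product rule the two orders differ by h f,
  which is the action of h.\<close>

lemma right_op_relator: "right_op h (Ah_relator h) f = 0"
proof -
  have "pderiv ([:0, 1:] * f) = f + [:0, 1:] * pderiv f"
    by (simp add: pderiv_pCons)
  then have "right_op h (Ah_relator h) f =
      [:0, 1:] * - (h * pderiv f) - - (h * (f + [:0, 1:] * pderiv f)) - h * f"
    by (simp only: Ah_relator_eq right_op_diff right_op_mult right_op_X right_op_Y right_op_fpoly)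
  also have "\<dots> = 0"
    by (simp only: distrib_left mult.left_commute[of h "[:0, 1:]"]) simp
  finally show ?thesis .
qed

section \<open>The defining ideal and the quotient map\<close>

lemma ring_of_type_simps [simp]:
  "carrier (ring_of_type_algebra :: 'r::ring_1 ring) = UNIV"
  "a \<oplus>\<^bsub>ring_of_type_algebra\<^esub> b = a + b" "a \<otimes>\<^bsub>ring_of_type_algebra\<^esub> b = a * b"
  "\<zero>\<^bsub>ring_of_type_algebra\<^esub> = 0" "\<one>\<^bsub>ring_of_type_algebra\<^esub> = 1"
  for a b :: "'r::ring_1"
  by (simp_all add: ring_of_type_algebra_def)

lemma ideal_ring_of_type:
  fixes J :: "'r::ring_1 set"
  shows "ideal J ring_of_type_algebra \<longleftrightarrow> two_sided_ideal J"
proof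
  assume "ideal J ring_of_type_algebra"
  then interpret ideal J "ring_of_type_algebra" .
  show "two_sided_ideal J"
    using additive_subgroup.zero_closed[OF is_additive_subgroup]
      additive_subgroup.a_closed[OF is_additive_subgroup] I_l_closed I_r_closed
    by (simp add: two_sided_ideal_def left_ideal_def)
next
  interpret R: ring "ring_of_type_algebra :: 'r ring" by (rule ring_of_type_ring_1)
  assume J: "two_sided_ideal J"
  note Jl = two_sided_idealD[OF J]
  have minus: "\<ominus>\<^bsub>ring_of_type_algebra\<^esub> a = - a" for a :: 'r
    using R.minus_equality[of "- a" a] by simp
  show "ideal J ring_of_type_algebra"
  proof (rule idealI)
    show "subgroup J (add_monoid ring_of_type_algebra)"
    proof (rule R.add.subgroupI)
      show "J \<noteq> {}" using left_ideal_zero[OF Jl] by blast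
      show "\<ominus>\<^bsub>ring_of_type_algebra\<^esub> a \<in> J" if "a \<in> J" for a
        using left_ideal_uminus[OF Jl that] by (simp add: minus)
      show "a \<oplus>\<^bsub>ring_of_type_algebra\<^esub> b \<in> J" if "a \<in> J" "b \<in> J" for a b
        using left_ideal_add[OF Jl that] by simp
    qed simp
  qed (simp_all add: left_ideal_mult[OF Jl] two_sided_ideal_mult_right[OF J] R.ring_axioms)
qed

lemma two_sided_ideal_Ah_ideal: "two_sided_ideal (Ah_ideal h)"
  using ideal_Ah_ideal by (simp add: ideal_ring_of_type)

lemma Ah_relator_in_ideal: "Ah_relator h \<in> Ah_ideal h"
  unfolding Ah_ideal_def by (rule ring.genideal_self'[OF ring_of_type_ring_1]) simp

text \<open>The elements that act as zero form a two-sided ideal containing the relator, so the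
  right action descends to \<open>Ah h\<close>.\<close>

lemma right_op_Ah_ideal:
  assumes "a \<in> Ah_ideal h" shows "right_op h a f = 0"
proof -
  let ?K = "{a. \<forall>f. right_op h a f = 0}"
  have "two_sided_ideal ?K"
    by (simp add: two_sided_ideal_def left_ideal_def right_op_zero_left right_op_zero_right
        right_op_add_left right_op_mult)
  then have "Ah_ideal h \<subseteq> ?K"
    unfolding Ah_ideal_def
    by (intro ring.genideal_minimal[OF ring_of_type_ring_1])
      (simp_all add: ideal_ring_of_type right_op_relator)
  then show ?thesis using assms by blast
qed

definition Ah_proj :: "'f::field poly \<Rightarrow> 'f free_algebra \<Rightarrow> 'f free_algebra set" where
  "Ah_proj h a = Ah_ideal h +>\<^bsub>ring_of_type_algebra\<^esub> a"

lemma type_quotient_Ah: "type_quotient (Ah h) (Ah_proj h)"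
proof -
  interpret I: ideal "Ah_ideal h" ring_of_type_algebra by (rule ideal_Ah_ideal)
  show ?thesis
  proof (intro type_quotient.intro type_quotient_axioms.intro ring_Ah)
    show "carrier (Ah h) = range (Ah_proj h)"
      by (auto simp: Ah_def Ah_proj_def FactRing_def A_RCOSETS_def')
    show "Ah_proj h (a + b) = Ah_proj h a \<oplus>\<^bsub>Ah h\<^esub> Ah_proj h b" for a b
      using I.a_rcos_sum[of a b] by (simp add: Ah_def Ah_proj_def FactRing_def)
    show "Ah_proj h (a * b) = Ah_proj h a \<otimes>\<^bsub>Ah h\<^esub> Ah_proj h b" for a b
      using I.rcoset_mult_add[of a b] by (simp add: Ah_def Ah_proj_def FactRing_def)
    show "Ah_proj h 1 = \<one>\<^bsub>Ah h\<^esub>"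
      by (simp add: Ah_def Ah_proj_def FactRing_def)
  qed
qed

lemma ker_Ah_proj: "type_quotient.ker (Ah h) (Ah_proj h) = Ah_ideal h"
proof -
  interpret type_quotient "Ah h" "Ah_proj h" by (rule type_quotient_Ah)
  note l = two_sided_idealD[OF two_sided_ideal_Ah_ideal[of h]]
  have proj: "Ah_proj h a = {i + a | i. i \<in> Ah_ideal h}" for a
    by (auto simp: Ah_proj_def a_r_coset_def')
  have "Ah_proj h a = Ah_ideal h \<longleftrightarrow> a \<in> Ah_ideal h" for a
  proof
    assume "Ah_proj h a = Ah_ideal h"
    moreover have "0 + a \<in> Ah_proj h a" using left_ideal_zero[OF l] unfolding proj by blast
    ultimately show "a \<in> Ah_ideal h" by simp
  next
    assume a: "a \<in> Ah_ideal h"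
    have "i \<in> Ah_proj h a" if "i \<in> Ah_ideal h" for i
      using left_ideal_diff[OF l that a] unfolding proj by (auto intro!: exI[of _ "i - a"])
    then show "Ah_proj h a = Ah_ideal h"
      using left_ideal_add[OF l _ a] unfolding proj by blast
  qed
  moreover have "\<zero>\<^bsub>Ah h\<^esub> = Ah_ideal h"
    by (simp add: Ah_def FactRing_def)
  ultimately show ?thesis
    unfolding ker_def by simp
qed

section \<open>Commutators and ideals in characteristic zero\<close>

text \<open>Commutation with y is a derivation that sends x to h, hence it acts on F[x] as h
  d/dx.\<close>

lemma gY_fpoly: "gY * fpoly f - fpoly f * gY - fpoly (h * pderiv f) \<in> Ah_ideal h"
proof (induction f)
  case 0
  then show ?case
    using left_ideal_zero[OF two_sided_idealD[OF two_sided_ideal_Ah_ideal]] by simp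
next
  case (pCons a f)
  note I = two_sided_ideal_Ah_ideal[of h]
  note Il = two_sided_idealD[OF I]
  have "gX * (gY * fpoly f - fpoly f * gY - fpoly (h * pderiv f)) + Ah_relator h * fpoly f \<in> Ah_ideal h"
    by (intro left_ideal_add[OF Il] left_ideal_mult[OF Il pCons(2)]
        two_sided_ideal_mult_right[OF I Ah_relator_in_ideal])
  moreover have "fpoly (h * pderiv (pCons a f)) = fpoly h * fpoly f + gX * fpoly (h * pderiv f)"
    by (simp add: pderiv_pCons fpoly_add fpoly_mult distrib_left fpoly_pCons fpoly_commute_X
        flip: mult.assoc)
  ultimately show ?case
    by (simp add: fpoly_pCons Ah_relator_eq algebra_simps free_const_commute)
qed

text \<open>Horner's scheme in y. Multiplying by \<open>gY\<close> on the right keeps the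
  coefficients from F[x] to the left of the powers of y.\<close>

definition npoly :: "'f::field poly poly \<Rightarrow> 'f free_algebra" where
  "npoly Q = fold_coeffs (\<lambda>a r. fpoly a + r * gY) Q 0"

lemma npoly_0 [simp]: "npoly 0 = 0"
  by (simp add: npoly_def)

lemma npoly_pCons: "npoly (pCons a Q) = fpoly a + npoly Q * gY"
  by (cases "a = 0 \<and> Q = 0") (auto simp: npoly_def)

lemma npoly_add: "npoly (P + Q) = npoly P + npoly Q"
  by (induction P Q rule: poly_induct2) (simp_all add: npoly_pCons fpoly_add distrib_right)

lemma npoly_smult: "npoly (Polynomial.smult f Q) = fpoly f * npoly Q"
  by (induction Q) (simp_all add: npoly_pCons fpoly_mult distrib_left mult.assoc)

lemma npoly_altdef:
  "Polynomial.degree Q \<le> n \<Longrightarrow> npoly Q = (\<Sum>j\<le>n. fpoly (Polynomial.coeff Q j) * gY ^ j)"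
proof (induction Q arbitrary: n)
  case (pCons a Q)
  show ?case
  proof (cases n)
    case 0
    then have "Q = 0" using pCons(1,3) by (auto split: if_splits)
    then show ?thesis using 0 by (simp add: npoly_pCons)
  next
    case (Suc m)
    then have "npoly Q = (\<Sum>j\<le>m. fpoly (Polynomial.coeff Q j) * gY ^ j)"
      using pCons by (intro pCons.IH) (auto split: if_splits)
    then show ?thesis
      unfolding Suc sum.atMost_Suc_shift
      by (simp add: npoly_pCons sum_distrib_right mult.assoc power_commutes)
  qed
qed simp

lemma npoly_mult_gY: "\<exists>Q'. gY * npoly Q - npoly Q' \<in> Ah_ideal h"
proof (induction Q)
  case 0
  then show ?case
    using left_ideal_zero[OF two_sided_idealD[OF two_sided_ideal_Ah_ideal]]
    by (intro exI[of _ 0]) simp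
next
  case (pCons a Q)
  note I = two_sided_ideal_Ah_ideal[of h]
  obtain Q' where Q': "gY * npoly Q - npoly Q' \<in> Ah_ideal h" using pCons by blast
  \<comment> \<open>Moving y past the constant term a gives a y + h a'. The summand a y joins the
    coefficient of y, hence \<open>[:a:]\<close> one place up.\<close>
  let ?R = "pCons (h * pderiv a) (Q' + [:a:])"
  have "gY * npoly (pCons a Q) - npoly ?R =
      (gY * fpoly a - fpoly a * gY - fpoly (h * pderiv a)) + (gY * npoly Q - npoly Q') * gY"
    by (simp add: npoly_pCons npoly_add algebra_simps)
  also have "\<dots> \<in> Ah_ideal h"
    by (intro left_ideal_add[OF two_sided_idealD[OF I]] gY_fpoly two_sided_ideal_mult_right[OF I Q'])
  finally show ?case by blast
qed

lemma normal_form: "\<exists>Q. r - npoly Q \<in> Ah_ideal h"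
proof (induction r rule: free_algebra_induct)
  case one
  then show ?case
    using left_ideal_zero[OF two_sided_idealD[OF two_sided_ideal_Ah_ideal]]
    by (intro exI[of _ "[:1:]"]) (simp add: npoly_pCons)
next
  note Il = two_sided_idealD[OF two_sided_ideal_Ah_ideal[of h]]
  case (add a b)
  then obtain P Q where "a - npoly P \<in> Ah_ideal h" "b - npoly Q \<in> Ah_ideal h" by blast
  from left_ideal_add[OF Il this] have "(a + b) - npoly (P + Q) \<in> Ah_ideal h"
    by (simp add: npoly_add algebra_simps)
  then show ?case by blast
next
  note Il = two_sided_idealD[OF two_sided_ideal_Ah_ideal[of h]]
  case (const c a)
  then obtain Q where "a - npoly Q \<in> Ah_ideal h" by blast
  from left_ideal_mult[OF Il this, of "free_const c"]
  have "free_const c * a - npoly (Polynomial.smult [:c:] Q) \<in> Ah_ideal h"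
    by (simp only: npoly_smult fpoly_const right_diff_distrib)
  then show ?case by blast
next
  note Il = two_sided_idealD[OF two_sided_ideal_Ah_ideal[of h]]
  case (X a)
  then obtain Q where "a - npoly Q \<in> Ah_ideal h" by blast
  from left_ideal_mult[OF Il this, of gX]
  have "gX * a - npoly (Polynomial.smult [:0, 1:] Q) \<in> Ah_ideal h"
    by (simp only: npoly_smult fpoly_x right_diff_distrib)
  then show ?case by blast
next
  note Il = two_sided_idealD[OF two_sided_ideal_Ah_ideal[of h]]
  case (Y a)
  then obtain Q where Q: "a - npoly Q \<in> Ah_ideal h" by blast
  obtain Q' where "gY * npoly Q - npoly Q' \<in> Ah_ideal h" using npoly_mult_gY by blast
  from left_ideal_add[OF Il left_ideal_mult[OF Il Q, of gY] this]
  have "gY * a - npoly Q' \<in> Ah_ideal h" by (simp add: right_diff_distrib)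
  then show ?case by blast
qed

section \<open>Iterated commutators with x\<close>

definition adX :: "'f::field free_algebra \<Rightarrow> 'f free_algebra" where
  "adX r = r * gX - gX * r"

lemma adX_diff: "adX (a - b) = adX a - adX b"
  by (simp add: adX_def algebra_simps)

lemma adX_in_ideal: "two_sided_ideal K \<Longrightarrow> r \<in> K \<Longrightarrow> (adX ^^ n) r \<in> K"
  by (induction n) (auto simp: adX_def intro!: left_ideal_diff dest: two_sided_idealD
      intro: two_sided_ideal_mult_right left_ideal_mult)

lemma adX_pow_add: "(adX ^^ n) (a + b) = (adX ^^ n) a + (adX ^^ n) b"
  by (induction n) (simp_all add: adX_def algebra_simps)

lemma adX_pow_zero: "(adX ^^ n) 0 = 0"
  by (induction n) (simp_all add: adX_def)

lemma adX_pow_fpoly: "(adX ^^ n) (fpoly f) = (if n = 0 then fpoly f else 0)"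
proof (induction n)
  case (Suc n)
  then show ?case by (cases n) (simp_all add: adX_def fpoly_commute_X)
qed simp

lemma of_nat_left_commute: "a * (of_nat n * b) = of_nat n * (a * (b :: 'a::semiring_1))"
  by (simp only: mult.assoc[symmetric] mult_of_nat_commute[symmetric])

text \<open>Leibniz rule for the inner derivation \<^const>\<open>adX\<close>, which maps \<open>y\<close> to \<open>h\<close> and kills \<open>h\<close>.\<close>

lemma adX_pow_mult_gY:
  "(adX ^^ Suc m) (r * gY) - (adX ^^ Suc m) r * gY - of_nat (Suc m) * ((adX ^^ m) r * fpoly h)
     \<in> Ah_ideal h"
proof (induction m)
  case 0
  have "r * Ah_relator h \<in> Ah_ideal h"
    by (rule left_ideal_mult[OF two_sided_idealD[OF two_sided_ideal_Ah_ideal] Ah_relator_in_ideal])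
  then show ?case by (simp add: adX_def Ah_relator_eq algebra_simps)
next
  case (Suc m)
  note I = two_sided_ideal_Ah_ideal[of h]
  note Il = two_sided_idealD[OF I]
  let ?a = "(adX ^^ Suc m) (r * gY)" and ?b = "(adX ^^ Suc m) r" and ?c = "(adX ^^ m) r"
  have hX: "fpoly h * gX = gX * fpoly h" by (rule fpoly_commute_X)
  \<comment> \<open>Adding the multiple of the relator trades the commutator of y and x for h. This
    gives one more summand and turns the factor m + 1 into m + 2.\<close>
  have "adX (?a - ?b * gY - of_nat (Suc m) * (?c * fpoly h)) + ?b * Ah_relator h \<in> Ah_ideal h"
    using adX_in_ideal[OF I Suc, of 1] left_ideal_mult[OF Il Ah_relator_in_ideal]
    by (intro left_ideal_add[OF Il]) simp_all
  moreover have "adX (?b * gY) = adX ?b * gY + ?b * (gY * gX - gX * gY)"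
    unfolding adX_def[of "?b * gY"] adX_def[of ?b] by (simp only: algebra_simps)
  moreover have "adX (of_nat (Suc m) * (?c * fpoly h)) = of_nat (Suc m) * (?b * fpoly h)"
    by (simp add: adX_def of_nat_left_commute left_diff_distrib right_diff_distrib mult.assoc hX
        del: of_nat_Suc)
  ultimately have "adX ?a - (adX ?b * gY + ?b * (gY * gX - gX * gY)) - of_nat (Suc m) * (?b * fpoly h)
      + ?b * Ah_relator h \<in> Ah_ideal h"
    by (simp only: adX_diff)
  also have "adX ?a - (adX ?b * gY + ?b * (gY * gX - gX * gY)) - of_nat (Suc m) * (?b * fpoly h)
      + ?b * Ah_relator h = adX ?a - adX ?b * gY - of_nat (Suc (Suc m)) * (?b * fpoly h)"
    by (simp add: Ah_relator_eq algebra_simps del: funpow.simps)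
  finally show ?case by simp
qed

text \<open>The bound n may exceed the degree. The coefficient is then 0, and the induction needs
  just this vanishing to discard the Leibniz term in which y is not differentiated.\<close>

lemma adX_pow_npoly:
  "Polynomial.degree Q \<le> n \<Longrightarrow>
     (adX ^^ n) (npoly Q) - fpoly (of_nat (fact n) * h ^ n * Polynomial.coeff Q n) \<in> Ah_ideal h"
proof (induction Q arbitrary: n)
  case 0
  then show ?case
    using left_ideal_zero[OF two_sided_idealD[OF two_sided_ideal_Ah_ideal]]
    by (simp add: adX_pow_zero)
next
  case (pCons a Q)
  note I = two_sided_ideal_Ah_ideal[of h]
  note Il = two_sided_idealD[OF I]
  show ?case
  proof (cases n)
    case 0
    then have "Q = 0" using pCons by (auto split: if_splits)
    then show ?thesis using 0 left_ideal_zero[OF Il] by (simp add: npoly_pCons)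
  next
    case (Suc m)
    then have deg: "Polynomial.degree Q \<le> m" using pCons by (auto split: if_splits)
    let ?A = "(adX ^^ Suc m) (npoly Q)" and ?B = "(adX ^^ m) (npoly Q)"
    let ?g = "of_nat (fact m) * h ^ m * Polynomial.coeff Q m"
    have "?A \<in> Ah_ideal h"
      using pCons.IH[of "Suc m"] deg by (simp add: Polynomial.coeff_eq_0)
    then have 1: "?A * gY \<in> Ah_ideal h" by (rule two_sided_ideal_mult_right[OF I])
    have 2: "of_nat (Suc m) * ((?B - fpoly ?g) * fpoly h) \<in> Ah_ideal h"
      by (intro left_ideal_mult[OF Il] two_sided_ideal_mult_right[OF I] pCons.IH deg)
    have eq: "fpoly (of_nat (fact n) * h ^ n * Polynomial.coeff (pCons a Q) n) =
        of_nat (Suc m) * (fpoly ?g * fpoly h)"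
    proof -
      have "of_nat (fact n) * h ^ n * Polynomial.coeff (pCons a Q) n = of_nat (Suc m) * (?g * h)"
        by (simp add: Suc algebra_simps)
      also have "fpoly \<dots> = of_nat (Suc m) * (fpoly ?g * fpoly h)"
        by (simp only: fpoly_mult of_nat_poly fpoly_const free_const_of_nat)
      finally show ?thesis .
    qed
    have "(adX ^^ n) (npoly (pCons a Q)) = (adX ^^ Suc m) (npoly Q * gY)"
      using Suc adX_pow_fpoly[of n a] by (simp add: npoly_pCons adX_pow_add del: funpow.simps)
    then have "(adX ^^ n) (npoly (pCons a Q)) - of_nat (Suc m) * (fpoly ?g * fpoly h) =
        ((adX ^^ Suc m) (npoly Q * gY) - ?A * gY - of_nat (Suc m) * (?B * fpoly h))
          + ?A * gY + of_nat (Suc m) * ((?B - fpoly ?g) * fpoly h)"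
      by (simp only:) (simp only: algebra_simps)
    also have "\<dots> \<in> Ah_ideal h"
      by (intro left_ideal_add[OF Il] adX_pow_mult_gY 1 2)
    finally show ?thesis unfolding eq .
  qed
qed

text \<open>By the lemma above, \<open>n\<close>-fold commutation with \<open>x\<close> turns an element of degree \<open>n\<close> in \<open>y\<close> into
  \<open>n!\<close> times \<open>h\<^sup>n\<close> times its leading coefficient.\<close>

lemma char_0_contains_fpoly:
  fixes h :: "'f::field poly"
  assumes "CHAR('f) = 0" "h \<noteq> 0" and K: "two_sided_ideal K" "Ah_ideal h \<subseteq> K" "K \<noteq> Ah_ideal h"
  obtains f where "f \<noteq> 0" "fpoly f \<in> K"
proof -
  note Il = two_sided_idealD[OF two_sided_ideal_Ah_ideal[of h]] and Kl = two_sided_idealD[OF K(1)]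
  obtain r where r: "r \<in> K" "r \<notin> Ah_ideal h" using K by blast
  obtain Q where Q: "r - npoly Q \<in> Ah_ideal h" using normal_form by blast
  have "Q \<noteq> 0" using Q r by auto
  let ?n = "Polynomial.degree Q"
  let ?f = "of_nat (fact ?n) * h ^ ?n * Polynomial.coeff Q ?n"
  have "of_nat (fact ?n) \<noteq> (0 :: 'f)"
    using assms(1) by (simp add: of_nat_eq_0_iff_char_dvd)
  then have "?f \<noteq> 0" using \<open>Q \<noteq> 0\<close> assms(2) by (simp add: of_nat_poly)
  moreover have "npoly Q \<in> K" using left_ideal_diff_iff[OF Kl, of r "npoly Q"] r Q K(2) by blast
  then have "(adX ^^ ?n) (npoly Q) \<in> K" by (rule adX_in_ideal[OF K(1)])
  then have "fpoly ?f \<in> K"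
    using left_ideal_diff_iff[OF Kl] adX_pow_npoly[of Q ?n h] K(2) by blast
  ultimately show ?thesis using that by blast
qed

text \<open>Modulo the relation, [y, h^k f] = k h' (h^k f) + h^(k+1) f'. The first summand already
  lies in K, so h^(k+1) f' does too. The degree of f drops, and in characteristic 0 only constants
  have derivative 0.\<close>

lemma char_0_contains_power:
  fixes h :: "'f::field poly"
  assumes "CHAR('f) = 0" and K: "two_sided_ideal K" "Ah_ideal h \<subseteq> K"
  shows "f \<noteq> 0 \<Longrightarrow> fpoly (h ^ k * f) \<in> K \<Longrightarrow> \<exists>n. fpoly (h ^ n) \<in> K"
proof (induction "Polynomial.degree f" arbitrary: f k rule: less_induct)
  case less
  note Kl = two_sided_idealD[OF K(1)]
  show ?case
  proof (cases "Polynomial.degree f = 0")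
    case True
    then obtain c where c: "f = [:c:]" by (auto elim: degree_eq_zeroE)
    have "fpoly ([:inverse c:] * (h ^ k * f)) \<in> K"
      unfolding fpoly_mult[of "[:inverse c:]"] using left_ideal_mult[OF Kl less(3)] .
    moreover have "[:inverse c:] * (h ^ k * f) = h ^ k"
      using less(2) c by simp
    ultimately show ?thesis by auto
  next
    case False
    then obtain n where n: "Polynomial.degree f = Suc n" using not0_implies_Suc by blast
    have "of_nat (Suc n) \<noteq> (0 :: 'f)"
      using assms(1) by (simp only: of_nat_eq_0_iff_char_dvd) simp
    moreover have "Polynomial.coeff f (Suc n) \<noteq> 0" using less(2) n by (metis leading_coeff_0_iff)
    ultimately have "Polynomial.coeff (pderiv f) n \<noteq> 0" by (simp add: coeff_pderiv)
    then have nz: "pderiv f \<noteq> 0" by auto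
    have deg: "Polynomial.degree (pderiv f) \<le> n"
      using n by (intro degree_le) (auto simp: coeff_pderiv Polynomial.coeff_eq_0)
    let ?g = "h ^ k * f"
    have "gY * fpoly ?g - fpoly ?g * gY \<in> K"
      by (intro left_ideal_diff[OF Kl] left_ideal_mult[OF Kl] two_sided_ideal_mult_right[OF K(1)] less)
    then have 1: "fpoly (h * pderiv ?g) \<in> K"
      using left_ideal_diff_iff[OF Kl, of "gY * fpoly ?g - fpoly ?g * gY"] gY_fpoly[of ?g h] K(2)
      by blast
    let ?d = "Polynomial.smult (of_nat k) (pderiv h)"
    have 2: "fpoly (?d * ?g) \<in> K"
      unfolding fpoly_mult[of ?d] using left_ideal_mult[OF Kl less(3)] .
    have "h * pderiv (h ^ k) = ?d * h ^ k"
    proof (cases k)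
      case (Suc n)
      show ?thesis unfolding Suc pderiv_power_Suc by (simp add: mult_ac)
    qed simp
    moreover have "h * pderiv ?g = h ^ Suc k * pderiv f + f * (h * pderiv (h ^ k))"
      by (simp add: pderiv_mult distrib_left mult_ac)
    ultimately have "h * pderiv ?g - ?d * ?g = h ^ Suc k * pderiv f"
      by (simp add: mult_ac)
    with left_ideal_diff[OF Kl 1 2] have "fpoly (h ^ Suc k * pderiv f) \<in> K"
      by (simp only: fpoly_diff[symmetric])
    then show ?thesis using less(1)[OF _ nz, of "Suc k"] deg n by simp
  qed
qed

text \<open>Since y h = h (y + h') modulo the relation, every t h can be written h t', so h R + L is
  a left ideal. It is larger than L because h is not in the core.\<close>

lemma gen_h_surj:
  assumes L: "max_left_ideal L" "Ah_ideal h \<subseteq> L" and h: "fpoly h \<notin> core L"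
  shows "\<exists>s. r - fpoly h * s \<in> L"
proof -
  note Ll = max_left_idealD(1)[OF L(1)]
  note I = two_sided_ideal_Ah_ideal[of h]
  note Il = two_sided_idealD[OF I]
  have normal: "\<exists>t'. t * fpoly h - fpoly h * t' \<in> Ah_ideal h" for t
  proof (induction t rule: free_algebra_induct)
    case one
    then show ?case using left_ideal_zero[OF Il] by (intro exI[of _ 1]) simp
  next
    case (add a b)
    then obtain a' b' where "a * fpoly h - fpoly h * a' \<in> Ah_ideal h"
      "b * fpoly h - fpoly h * b' \<in> Ah_ideal h" by blast
    from left_ideal_add[OF Il this] show ?case
      by (intro exI[of _ "a' + b'"]) (simp add: algebra_simps)
  next
    case (const c a)
    then obtain a' where "a * fpoly h - fpoly h * a' \<in> Ah_ideal h" by blast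
    from left_ideal_mult[OF Il this, of "free_const c"] show ?case
      by (intro exI[of _ "free_const c * a'"])
        (simp only: right_diff_distrib mult.assoc free_const_left_commute)
  next
    case (X a)
    then obtain a' where "a * fpoly h - fpoly h * a' \<in> Ah_ideal h" by blast
    from left_ideal_mult[OF Il this, of gX] show ?case
      by (intro exI[of _ "gX * a'"])
        (simp only: right_diff_distrib mult.assoc[symmetric] fpoly_commute_X)
  next
    case (Y a)
    then obtain a' where a': "a * fpoly h - fpoly h * a' \<in> Ah_ideal h" by blast
    have "gY * (a * fpoly h - fpoly h * a') + (gY * fpoly h - fpoly h * gY - fpoly (h * pderiv h)) * a'
        \<in> Ah_ideal h"
      by (intro left_ideal_add[OF Il] left_ideal_mult[OF Il a'] two_sided_ideal_mult_right[OF I] gY_fpoly)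
    then show ?case
      by (intro exI[of _ "gY * a' + fpoly (pderiv h) * a'"]) (simp add: fpoly_mult algebra_simps)
  qed
  let ?K = "{a. \<exists>s. a - fpoly h * s \<in> L}"
  have "left_ideal ?K"
    unfolding left_ideal_def
  proof (intro conjI ballI allI)
    show "0 \<in> ?K" using left_ideal_zero[OF Ll] by (auto intro!: exI[of _ 0])
    show "a + b \<in> ?K" if "a \<in> ?K" "b \<in> ?K" for a b
    proof -
      from that obtain s t where "a - fpoly h * s \<in> L" "b - fpoly h * t \<in> L" by blast
      from left_ideal_add[OF Ll this] have "a + b - fpoly h * (s + t) \<in> L"
        by (simp add: algebra_simps)
      then show ?thesis by blast
    qed
    show "t * a \<in> ?K" if "a \<in> ?K" for t a
    proof -
      from that obtain s where s: "a - fpoly h * s \<in> L" by blast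
      obtain t' where "t * fpoly h - fpoly h * t' \<in> Ah_ideal h" using normal by blast
      then have "(t * fpoly h - fpoly h * t') * s \<in> L"
        using two_sided_ideal_mult_right[OF I] L(2) by blast
      from left_ideal_add[OF Ll left_ideal_mult[OF Ll s, of t] this]
      have "t * a - fpoly h * (t' * s) \<in> L" by (simp add: algebra_simps)
      then show ?thesis by blast
    qed
  qed
  moreover have "L \<subseteq> ?K" by (auto intro!: exI[of _ 0])
  moreover obtain u where u: "fpoly h * u \<notin> L" using h by (auto simp: core_def)
  moreover have "fpoly h * u \<in> ?K" using left_ideal_zero[OF Ll] by (auto intro!: exI[of _ u])
  ultimately have "?K = UNIV" by (intro max_left_ideal_bigger[OF L(1) _ _ _ u])
  then show ?thesis by blast
qed

text \<open>If h is outside the core, it acts surjectively on R / L. So does each of its powers, and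
  none of them can act as zero.\<close>

lemma gen_h_power_core:
  assumes L: "max_left_ideal L" "Ah_ideal h \<subseteq> L" and h: "fpoly (h ^ n) \<in> core L"
  shows "fpoly h \<in> core L"
proof (rule ccontr)
  assume nh: "fpoly h \<notin> core L"
  note Ll = max_left_idealD(1)[OF L(1)]
  have "\<exists>s. r - fpoly (h ^ n) * s \<in> L" for n r
  proof (induction n arbitrary: r)
    case 0
    then show ?case using left_ideal_zero[OF Ll] by (intro exI[of _ r]) simp
  next
    case (Suc n)
    obtain s where s: "r - fpoly h * s \<in> L" using gen_h_surj[OF L nh] by blast
    obtain t where t: "s - fpoly (h ^ n) * t \<in> L" using Suc by blast
    have "r - fpoly (h ^ Suc n) * t = (r - fpoly h * s) + fpoly h * (s - fpoly (h ^ n) * t)"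
      by (simp add: fpoly_mult algebra_simps)
    then show ?case using left_ideal_add[OF Ll s left_ideal_mult[OF Ll t]] by metis
  qed
  then obtain s where s: "1 - fpoly (h ^ n) * s \<in> L" by blast
  have "fpoly (h ^ n) * s \<in> L" using h by (simp add: core_def)
  from left_ideal_add[OF Ll s this] show False using max_left_idealD(2)[OF L(1)] by simp
qed

lemma char_0_core:
  fixes h :: "'f::field poly"
  assumes "CHAR('f) = 0" "h \<noteq> 0" and L: "max_left_ideal L" "Ah_ideal h \<subseteq> L"
    and ne: "core L \<noteq> Ah_ideal h"
  shows "fpoly h \<in> core L"
proof -
  note c = two_sided_ideal_core[OF max_left_idealD(1)[OF L(1)]]
    two_sided_ideal_subset_core[OF two_sided_ideal_Ah_ideal L(2)]
  obtain f where f: "f \<noteq> 0" "fpoly f \<in> core L"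
    using char_0_contains_fpoly[OF assms(1,2) c ne] .
  then obtain n where "fpoly (h ^ n) \<in> core L"
    using char_0_contains_power[OF assms(1) c, of f 0] by auto
  then show ?thesis by (rule gen_h_power_core[OF L])
qed

text \<open>The elements that commute with z modulo K form a subalgebra, so the generators
  suffice.\<close>

lemma central_modI:
  assumes K: "two_sided_ideal K" and X: "z * gX - gX * z \<in> K" and Y: "z * gY - gY * z \<in> K"
  shows "z * r - r * z \<in> K"
proof (induction r rule: free_algebra_induct)
  note Kl = two_sided_idealD[OF K]
  case one
  then show ?case using left_ideal_zero[OF Kl] by simp
next
  note Kl = two_sided_idealD[OF K]
  case (add a b)
  from left_ideal_add[OF Kl this] show ?case by (simp add: algebra_simps)
next
  note Kl = two_sided_idealD[OF K]
  case (const c a)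
  from left_ideal_mult[OF Kl this, of "free_const c"] show ?case
    by (simp only: right_diff_distrib mult.assoc free_const_left_commute)
next
  note Kl = two_sided_idealD[OF K]
  case (X a)
  from left_ideal_add[OF Kl left_ideal_mult[OF Kl this, of gX]
      two_sided_ideal_mult_right[OF K assms(2), of a]]
  show ?case by (simp add: algebra_simps)
next
  note Kl = two_sided_idealD[OF K]
  case (Y a)
  from left_ideal_add[OF Kl left_ideal_mult[OF Kl this, of gY]
      two_sided_ideal_mult_right[OF K assms(3), of a]]
  show ?case by (simp add: algebra_simps)
qed

text \<open>With h in K the relator becomes the commutator of y and x. Hence x and y are central
  modulo K, and then every a is.\<close>

lemma commutative_mod:
  assumes K: "two_sided_ideal K" "Ah_ideal h \<subseteq> K" and h: "fpoly h \<in> K"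
  shows "a * b - b * a \<in> K"
proof -
  note Kl = two_sided_idealD[OF K(1)]
  have "Ah_relator h + fpoly h \<in> K"
    using K(2) h Ah_relator_in_ideal[of h] by (intro left_ideal_add[OF Kl]) auto
  then have YX: "gY * gX - gX * gY \<in> K" by (simp add: Ah_relator_eq)
  then have XY: "gX * gY - gY * gX \<in> K" by (rule left_ideal_cong_sym[OF Kl])
  have "gX * r - r * gX \<in> K" for r
    by (rule central_modI[OF K(1) _ XY]) (simp add: left_ideal_zero[OF Kl])
  then have X: "r * gX - gX * r \<in> K" for r by (rule left_ideal_cong_sym[OF Kl])
  have "gY * r - r * gY \<in> K" for r
    by (rule central_modI[OF K(1) YX]) (simp add: left_ideal_zero[OF Kl])
  then have Y: "r * gY - gY * r \<in> K" for r by (rule left_ideal_cong_sym[OF Kl])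
  show ?thesis by (rule central_modI[OF K(1) X Y])
qed

text \<open>Everything is central modulo the core, so the whole ring serves as Z and 1 is the only
  generator.\<close>

lemma core_maximal_commutative:
  assumes L: "max_left_ideal L" "Ah_ideal h \<subseteq> L" and h: "fpoly h \<in> core L"
    and J: "two_sided_ideal J" "core L \<subseteq> J" "J \<noteq> core L"
  shows "1 \<in> J"
proof (rule core_maximal[OF L(1) _ _ _ J, of "{1}" UNIV])
  show "z * r - r * z \<in> core L" for z r
    using two_sided_ideal_core[OF max_left_idealD(1)[OF L(1)]]
      two_sided_ideal_subset_core[OF two_sided_ideal_Ah_ideal L(2)] h by (rule commutative_mod)
  have "r \<in> comb UNIV {1} (core L)" for r
    using comb_gen[of r UNIV 1 "{1}" "core L"] by simp
  then show "comb UNIV {1} (core L) = UNIV" by blast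
qed simp

section \<open>Central elements in positive characteristic\<close>

lemma comb_sum: "left_ideal N \<Longrightarrow> (\<And>i. i \<in> A \<Longrightarrow> f i \<in> comb Z S N) \<Longrightarrow> sum f A \<in> comb Z S N"
  by (induction A rule: infinite_finite_induct) (auto intro: comb_add comb_base left_ideal_zero)

lemma comb_mult:
  assumes N: "left_ideal N" and Z: "\<And>z w. z \<in> Z \<Longrightarrow> w \<in> Z \<Longrightarrow> z * w \<in> Z"
    and z: "z \<in> Z" and w: "w \<in> comb Z S N"
  shows "z * w \<in> comb Z S N"
  using w
proof induction
  case (comb_base a)
  then show ?case by (intro comb.comb_base left_ideal_mult[OF N])
next
  case (comb_gen y s)
  then have "(z * y) * s \<in> comb Z S N" by (intro comb.comb_gen Z z)
  then show ?case by (simp add: mult.assoc)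
next
  case (comb_add a b)
  from comb.comb_add[OF comb_add(3,4)] show ?case by (simp add: distrib_left)
qed

lemma comb_cong: "left_ideal N \<Longrightarrow> a - b \<in> N \<Longrightarrow> b \<in> comb Z S N \<Longrightarrow> a \<in> comb Z S N"
  using comb_add[OF comb_base, of "a - b" N b Z S] by simp

definition monomials :: "nat \<Rightarrow> nat \<Rightarrow> 'f::field free_algebra set" where
  "monomials m n = (\<lambda>(i, j). gX ^ i * gY ^ j) ` ({..<m} \<times> {..<n})"

lemma finite_monomials [simp]: "finite (monomials m n)"
  by (simp add: monomials_def)

text \<open>The rules for x^m and y^n keep the span of the x^i y^j stable under left multiplication
  by x and by y. In characteristic p the elements z0 and z1 are x^p and y^p - c y; over the scalars
  both are 0 and the rules are algebraic equations for x and y.\<close>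

lemma comb_monomials:
  fixes h :: "'f::field poly"
  assumes K: "two_sided_ideal K" "Ah_ideal h \<subseteq> K"
    and central: "\<And>z r. z \<in> Z \<Longrightarrow> z * r - r * z \<in> K"
    and Zmult: "\<And>z w. z \<in> Z \<Longrightarrow> w \<in> Z \<Longrightarrow> z * w \<in> Z"
    and const: "\<And>c. free_const c \<in> Z"
    and m: "0 < m" "z0 \<in> Z" "Polynomial.degree u < m" "gX ^ m - (z0 + fpoly u) \<in> K"
    and n: "0 < n" "z1 \<in> Z" "gY ^ n - (z1 + (\<Sum>j<n. fpoly (\<beta> j) * gY ^ j)) \<in> K"
  shows "comb Z (monomials m n) K = UNIV"
proof -
  note Kl = two_sided_idealD[OF K(1)]
  define W where "W = comb Z (monomials m n) K"
  have W_add: "a + b \<in> W" if "a \<in> W" "b \<in> W" for a b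
    using that unfolding W_def by (rule comb_add)
  have W_K: "a \<in> W" if "a \<in> K" for a
    using that unfolding W_def by (rule comb_base)
  have W_mult: "z * a \<in> W" if "z \<in> Z" "a \<in> W" for z a
    using comb_mult[OF Kl Zmult] that unfolding W_def by blast
  have W_sum: "sum f A \<in> W" if "\<And>i. i \<in> A \<Longrightarrow> f i \<in> W" for f :: "nat \<Rightarrow> 'f free_algebra" and A
    using comb_sum[OF Kl] that unfolding W_def by blast
  have W_cong: "a \<in> W" if "a - b \<in> K" "b \<in> W" for a b
    using comb_cong[OF Kl] that unfolding W_def by blast
  have mon: "gX ^ i * gY ^ j \<in> W" if "i < m" "j < n" for i j
  proof -
    have "gX ^ i * gY ^ j \<in> monomials m n"
      unfolding monomials_def using that by (intro image_eqI[of _ _ "(i, j)"]) auto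
    then have "free_const 1 * (gX ^ i * gY ^ j) \<in> W"
      unfolding W_def by (intro comb_gen const)
    then show ?thesis by simp
  qed
  have low: "fpoly f * gY ^ j \<in> W" if "Polynomial.degree f < m" "j < n" for f j
    unfolding fpoly_def sum_distrib_right
  proof (rule W_sum)
    fix i assume "i \<in> {..Polynomial.degree f}"
    then have "gX ^ i * gY ^ j \<in> W" using that by (intro mon) auto
    then show "free_const (Polynomial.coeff f i) * gX ^ i * gY ^ j \<in> W"
      using W_mult[OF const] by (simp add: mult.assoc)
  qed
  have top: "gX ^ m * gY ^ j \<in> W" if "j < n" for j
  proof (rule W_cong)
    show "gX ^ m * gY ^ j - (z0 * gY ^ j + fpoly u * gY ^ j) \<in> K"
      using two_sided_ideal_mult_right[OF K(1) m(4), of "gY ^ j"] by (simp add: algebra_simps)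
    have "gY ^ j \<in> W" using mon[of 0 j] m(1) that by simp
    then show "z0 * gY ^ j + fpoly u * gY ^ j \<in> W"
      by (intro W_add W_mult m low that)
  qed
  have W_X: "gX * w \<in> W" if "w \<in> W" for w
    using that[unfolded W_def]
  proof induction
    case (comb_base a)
    then show ?case by (intro W_K left_ideal_mult[OF Kl])
  next
    case (comb_gen z s)
    then obtain i j where ij: "s = gX ^ i * gY ^ j" "i < m" "j < n"
      by (auto simp: monomials_def)
    have "gX ^ Suc i * gY ^ j \<in> W"
      using mon[of "Suc i" j] top[of j] ij by (cases "Suc i = m") auto
    then have "gX * s \<in> W" by (simp add: ij mult.assoc)
    moreover have "(gX * z - z * gX) * s \<in> K"
      using two_sided_ideal_mult_right[OF K(1) left_ideal_cong_sym[OF Kl central[OF comb_gen(1)]]] .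
    then have "gX * (z * s) - z * (gX * s) \<in> K" by (simp add: algebra_simps)
    ultimately show ?case using W_mult[OF comb_gen(1)] W_cong by blast
  next
    case (comb_add a b)
    from W_add[OF comb_add(3,4)] show ?case by (simp add: distrib_left)
  qed
  \<comment> \<open>Polynomials of any degree are needed in the step for y, where h (x^i)' and the
    \<open>\<beta> j\<close> occur as coefficients.\<close>
  have W_fpoly: "fpoly f * w \<in> W" if "w \<in> W" for f w
  proof (induction f)
    case 0
    then show ?case using W_K[OF left_ideal_zero[OF Kl]] by simp
  next
    case (pCons c f)
    from W_add[OF W_mult[OF const that, of c] W_X[OF pCons(2)]] show ?case
      by (simp add: fpoly_pCons distrib_right mult.assoc)
  qed
  have one: "1 \<in> W" using mon[of 0 0] m(1) n(1) by simp
  have pow: "gY ^ j \<in> W" if "j \<le> n" for j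
  proof (cases "j = n")
    case False
    then show ?thesis using mon[of 0 j] m(1) that by simp
  next
    case True
    have "z1 * 1 + (\<Sum>j<n. fpoly (\<beta> j) * gY ^ j) \<in> W"
      using mon[of 0] m(1) by (intro W_add[OF W_mult[OF n(2) one]] W_sum W_fpoly) simp
    then show ?thesis using W_cong[OF n(3)] True by simp
  qed
  have W_Y: "gY * w \<in> W" if "w \<in> W" for w
    using that[unfolded W_def]
  proof induction
    case (comb_base a)
    then show ?case by (intro W_K left_ideal_mult[OF Kl])
  next
    case (comb_gen z s)
    then obtain i j where ij: "s = gX ^ i * gY ^ j" "i < m" "j < n"
      by (auto simp: monomials_def)
    let ?f = "[:0, 1:] ^ i"
    have s: "s = fpoly ?f * gY ^ j" by (simp only: ij fpoly_power fpoly_x)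
    have "(gY * fpoly ?f - fpoly ?f * gY - fpoly (h * pderiv ?f)) * gY ^ j \<in> K"
      using gY_fpoly K(2) by (intro two_sided_ideal_mult_right[OF K(1)]) blast
    then have "gY * s - (fpoly ?f * gY ^ Suc j + fpoly (h * pderiv ?f) * gY ^ j) \<in> K"
      by (simp only: s left_diff_distrib distrib_right mult.assoc power_Suc diff_diff_eq)
    moreover have "fpoly ?f * gY ^ Suc j + fpoly (h * pderiv ?f) * gY ^ j \<in> W"
      using ij by (intro W_add W_fpoly pow) auto
    ultimately have "gY * s \<in> W" by (rule W_cong)
    moreover have "(gY * z - z * gY) * s \<in> K"
      using two_sided_ideal_mult_right[OF K(1) left_ideal_cong_sym[OF Kl central[OF comb_gen(1)]]] .
    then have "gY * (z * s) - z * (gY * s) \<in> K" by (simp add: algebra_simps)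
    ultimately show ?case using W_mult[OF comb_gen(1)] W_cong by blast
  next
    case (comb_add a b)
    from W_add[OF comb_add(3,4)] show ?case by (simp add: distrib_left)
  qed
  have "r \<in> W" for r
    by (induction r rule: free_algebra_induct)
      (auto intro: one W_add W_X W_Y W_mult const)
  then show ?thesis unfolding W_def by blast
qed

text \<open>Left multiplication by a is the sum of D and right multiplication by a. These two maps
  commute, so the binomial theorem applies to their sum.\<close>

lemma mult_pow_ad:
  fixes a r :: "'r::ring_1"
  defines "D \<equiv> (\<lambda>s. a * s - s * a)"
  shows "a ^ n * r = (\<Sum>k\<le>n. of_nat (n choose k) * (D ^^ k) r * a ^ (n - k))"
proof (induction n)
  case (Suc n)
  let ?t = "\<lambda>c k m. of_nat c * (D ^^ k) r * a ^ m"
  have step: "a * ?t c k m = ?t c (Suc k) m + ?t c k (Suc m)" for c k m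
    by (simp add: D_def algebra_simps of_nat_left_commute)
  have "a ^ Suc n * r = (\<Sum>k\<le>n. a * ?t (n choose k) k (n - k))"
    by (simp add: mult.assoc Suc sum_distrib_left)
  also have "\<dots> = (\<Sum>k\<le>n. ?t (n choose k) (Suc k) (n - k)) + (\<Sum>k\<le>n. ?t (n choose k) k (Suc (n - k)))"
    by (simp only: step sum.distrib)
  also have "(\<Sum>k\<le>n. ?t (n choose k) k (Suc (n - k))) = (\<Sum>k\<le>Suc n. ?t (n choose k) k (Suc n - k))"
    by (simp add: Suc_diff_le binomial_eq_0)
  also have "\<dots> = ?t 1 0 (Suc n) + (\<Sum>k\<le>n. ?t (n choose Suc k) (Suc k) (n - k))"
    by (simp only: sum.atMost_Suc_shift) simp
  also have "(\<Sum>k\<le>n. ?t (n choose k) (Suc k) (n - k)) + \<dots> =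
      ?t 1 0 (Suc n) + (\<Sum>k\<le>n. ?t (Suc n choose Suc k) (Suc k) (n - k))"
    by (simp add: distrib_right sum.distrib add_ac)
  also have "\<dots> = (\<Sum>k\<le>Suc n. ?t (Suc n choose k) k (Suc n - k))"
    by (simp only: sum.atMost_Suc_shift) simp
  finally show ?case .
qed simp

text \<open>The binomial coefficients with 0 < k < p are divisible by p and vanish in the ring, so
  ad(a^p) = ad(a)^p.\<close>

lemma mult_prime_pow_ad:
  fixes a r :: "'r::ring_1"
  assumes p: "Factorial_Ring.prime p" "of_nat p = (0 :: 'r)"
  shows "a ^ p * r - r * a ^ p = ((\<lambda>s. a * s - s * a) ^^ p) r"
proof -
  let ?D = "\<lambda>s. a * s - s * a"
  have p0: "p > 0" using p(1) by (rule prime_gt_0_nat)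
  have "a ^ p * r = (\<Sum>k\<le>p. of_nat (p choose k) * (?D ^^ k) r * a ^ (p - k))"
    by (rule mult_pow_ad)
  also have "\<dots> = (\<Sum>k\<in>{0, p}. of_nat (p choose k) * (?D ^^ k) r * a ^ (p - k))"
  proof (rule sum.mono_neutral_right)
    show "\<forall>k\<in>{..p} - {0, p}. of_nat (p choose k) * (?D ^^ k) r * a ^ (p - k) = 0"
    proof
      fix k assume "k \<in> {..p} - {0, p}"
      then have "p dvd (p choose k)" using p p0 by (intro dvd_choose_prime) auto
      then obtain q where q: "p choose k = p * q" by blast
      have "of_nat (p choose k) = (0 :: 'r)" unfolding q using p(2) by simp
      then show "of_nat (p choose k) * (?D ^^ k) r * a ^ (p - k) = 0" by simp
    qed
  qed auto
  also have "\<dots> = r * a ^ p + (?D ^^ p) r" using p0 by simp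
  finally show ?thesis by simp
qed

text \<open>In the right module f sends 1 to f, so F[x] embeds into \<open>Ah h\<close>.\<close>

lemma fpoly_in_Ah_ideal:
  assumes "fpoly f \<in> Ah_ideal h" shows "f = 0"
  using right_op_Ah_ideal[OF assms, of 1] by (simp add: right_op_fpoly)

lemma fpoly_central_commute:
  assumes I: "left_ideal I" and z: "z * gX - gX * z \<in> I" and I2: "two_sided_ideal I"
  shows "z * fpoly f - fpoly f * z \<in> I"
proof (induction f)
  case 0
  then show ?case using left_ideal_zero[OF I] by simp
next
  case (pCons c f)
  have "(z * gX - gX * z) * fpoly f + gX * (z * fpoly f - fpoly f * z) \<in> I"
    by (intro left_ideal_add[OF I] left_ideal_mult[OF I pCons(2)] two_sided_ideal_mult_right[OF I2 z])
  then show ?case by (simp add: fpoly_pCons algebra_simps free_const_commute)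
qed

text \<open>In characteristic \<open>p\<close> the derivation \<open>\<delta> = ad y\<close> of \<open>F[x]\<close> satisfies \<open>\<delta>\<^sup>p = c \<delta>\<close>,
  and \<open>\<delta>\<^sup>p = ad (y\<^sup>p)\<close>, so \<open>y\<^sup>p - c y\<close> is central.\<close>

lemma char_p_central:
  fixes h :: "'f::field poly"
  assumes h: "h \<noteq> 0" and p: "Factorial_Ring.prime p" "p = CHAR('f)"
  shows "\<exists>c. \<forall>r. (gY ^ p - fpoly c * gY) * r - r * (gY ^ p - fpoly c * gY) \<in> Ah_ideal h"
proof -
  note I = two_sided_ideal_Ah_ideal[of h]
  note Il = two_sided_idealD[OF I]
  let ?E = "\<lambda>s. gY * s - s * gY" and ?\<delta> = "\<lambda>f. h * pderiv f"
  have p0: "of_nat p = (0 :: 'f free_algebra)"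
    by (simp add: p(2) flip: free_const_of_nat)
  have E: "(?E ^^ n) (fpoly f) - fpoly ((?\<delta> ^^ n) f) \<in> Ah_ideal h" for n f
  proof (induction n)
    case (Suc n)
    let ?a = "(?E ^^ n) (fpoly f)" and ?g = "(?\<delta> ^^ n) f"
    have "(gY * (?a - fpoly ?g) - (?a - fpoly ?g) * gY)
        + (gY * fpoly ?g - fpoly ?g * gY - fpoly (h * pderiv ?g)) \<in> Ah_ideal h"
      by (intro left_ideal_add[OF Il] left_ideal_diff[OF Il] left_ideal_mult[OF Il Suc]
          two_sided_ideal_mult_right[OF I Suc] gY_fpoly)
    then show ?case by (simp add: algebra_simps)
  qed (use left_ideal_zero[OF Il] in simp)
  obtain k where k: "p = Suc k" using p(1) prime_gt_0_nat gr0_implies_Suc by blast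
  \<comment> \<open>With p = k + 1, the last application of \<delta> contributes the factor h, so
    \<delta>^p maps x to h c. As [y, x] = h, the elements c y and y^p have the same commutator with
    x.\<close>
  define c where "c = pderiv ((?\<delta> ^^ k) [:0, 1:])"
  have \<delta>p: "(?\<delta> ^^ p) [:0, 1:] = h * c" by (simp add: k c_def)
  define z where "z = gY ^ p - fpoly c * gY"
  have zX: "z * gX - gX * z \<in> Ah_ideal h"
  proof -
    have "(gY ^ p * gX - gX * gY ^ p) - fpoly (h * c) \<in> Ah_ideal h"
      using E[of p "[:0, 1:]"] unfolding mult_prime_pow_ad[OF p(1) p0] \<delta>p fpoly_x .
    from left_ideal_diff[OF Il this left_ideal_mult[OF Il Ah_relator_in_ideal, of "fpoly c"]]
    have "(gY ^ p * gX - gX * gY ^ p) - fpoly (h * c) - fpoly c * Ah_relator h \<in> Ah_ideal h" .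
    also have "(gY ^ p * gX - gX * gY ^ p) - fpoly (h * c) - fpoly c * Ah_relator h = z * gX - gX * z"
    proof -
      have "fpoly c * (gX * gY) = gX * (fpoly c * gY)"
        by (simp only: mult.assoc[symmetric] fpoly_commute_X)
      then show ?thesis
        by (simp add: z_def Ah_relator_eq fpoly_mult fpoly_commute[of h] algebra_simps)
    qed
    finally show ?thesis .
  qed
  let ?g = "h * pderiv c"
  \<comment> \<open>The power y^p drops out, and [z, y] = [y, c] y with [y, c] = h c'.\<close>
  have zY: "(z * gY - gY * z) - fpoly ?g * gY \<in> Ah_ideal h"
  proof -
    have "(gY * fpoly c - fpoly c * gY - fpoly ?g) * gY \<in> Ah_ideal h"
      by (intro two_sided_ideal_mult_right[OF I] gY_fpoly)
    also have "(gY * fpoly c - fpoly c * gY - fpoly ?g) * gY = (z * gY - gY * z) - fpoly ?g * gY"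
      by (simp add: z_def algebra_simps power_commutes)
    finally show ?thesis .
  qed
  text \<open>By the Jacobi identity, \<open>[z, [y, x]] = [z, h] = 0\<close> forces \<open>\<delta>(c) h = 0\<close>.\<close>
  have "fpoly (?g * h) \<in> Ah_ideal h"
  proof -
    let ?R = "Ah_relator h" and ?u = "z * gX - gX * z"
      and ?v = "(z * gY - gY * z) - fpoly ?g * gY"
    have zh: "z * fpoly h - fpoly h * z \<in> Ah_ideal h"
      by (rule fpoly_central_commute[OF Il zX I])
    \<comment> \<open>The double commutators of z, y and x cancel by the Jacobi identity. What is
      left is [g y, x] minus g times the relator, which is g h, where g = h c'.\<close>
    have "z * ?R - ?R * z + (z * fpoly h - fpoly h * z) - (?v * gX - gX * ?v) - (gY * ?u - ?u * gY)
        - fpoly ?g * ?R \<in> Ah_ideal h"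
      by (intro left_ideal_diff[OF Il] left_ideal_add[OF Il] left_ideal_mult[OF Il]
          two_sided_ideal_mult_right[OF I] Ah_relator_in_ideal zX zY zh)
    also have "z * ?R - ?R * z + (z * fpoly h - fpoly h * z) - (?v * gX - gX * ?v) - (gY * ?u - ?u * gY)
        - fpoly ?g * ?R = fpoly (?g * h)"
    proof -
      have "gX * (fpoly ?g * gY) = fpoly ?g * (gX * gY)"
        by (simp only: mult.assoc[symmetric] fpoly_commute_X)
      then show ?thesis
        unfolding fpoly_mult[of ?g h] by (simp add: Ah_relator_eq algebra_simps)
    qed
    finally show ?thesis .
  qed
  then have "?g = 0" using fpoly_in_Ah_ideal h by fastforce
  then have "z * gY - gY * z \<in> Ah_ideal h" using zY by (simp only: fpoly_zero) simp
  with central_modI[OF I zX] show ?thesis unfolding z_def by blast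
qed

lemma core_maximal_char_p:
  fixes h :: "'f::field poly"
  assumes h: "h \<noteq> 0" and ch: "CHAR('f) \<noteq> 0" and L: "max_left_ideal L" "Ah_ideal h \<subseteq> L"
    and J: "two_sided_ideal J" "core L \<subseteq> J" "J \<noteq> core L"
  shows "1 \<in> J"
proof -
  define p where "p = CHAR('f)"
  have p: "Factorial_Ring.prime p" using prime_CHAR_semidom ch unfolding p_def by blast
  have p1: "1 < p" using p by (rule prime_gt_1_nat)
  let ?K = "core L"
  have K: "two_sided_ideal ?K" "Ah_ideal h \<subseteq> ?K"
    using two_sided_ideal_core[OF max_left_idealD(1)[OF L(1)]]
      two_sided_ideal_subset_core[OF two_sided_ideal_Ah_ideal L(2)] .
  note Kl = two_sided_idealD[OF K(1)]
  define Z where "Z = {z. \<forall>r. z * r - r * z \<in> ?K}"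
  obtain c where c: "\<And>r. (gY ^ p - fpoly c * gY) * r - r * (gY ^ p - fpoly c * gY) \<in> Ah_ideal h"
    using char_p_central[OF h p p_def] by blast
  have Zmult: "z * w \<in> Z" if zw: "z \<in> Z" "w \<in> Z" for z w
  proof -
    have "z * (w * r - r * w) + (z * r - r * z) * w \<in> ?K" for r
      using zw unfolding Z_def
      by (intro left_ideal_add[OF Kl] left_ideal_mult[OF Kl] two_sided_ideal_mult_right[OF K(1)]) auto
    then show ?thesis by (simp add: Z_def algebra_simps)
  qed
  have const: "free_const a \<in> Z" for a
    using left_ideal_zero[OF Kl] by (simp add: Z_def free_const_commute)
  \<comment> \<open>The derivative of x^p vanishes in characteristic p, so x^p commutes with
    y.\<close>
  have ZX: "gX ^ p \<in> Z"
  proof -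
    have "pderiv ([:0, 1:] ^ p :: 'f poly) = 0"
      using of_nat_CHAR[where ?'a = 'f] by (simp add: pderiv_power p_def)
    then have "gY * gX ^ p - gX ^ p * gY \<in> Ah_ideal h"
      using gY_fpoly[of "[:0, 1:] ^ p" h] by (simp add: fpoly_power fpoly_x del: mult_pCons_left)
    then have "gX ^ p * gY - gY * gX ^ p \<in> ?K"
      using K(2) left_ideal_cong_sym[OF Kl] by blast
    then have "gX ^ p * r - r * gX ^ p \<in> ?K" for r
      by (rule central_modI[OF K(1), rotated]) (simp add: power_commutes left_ideal_zero[OF Kl])
    then show ?thesis by (simp add: Z_def)
  qed
  have ZY: "gY ^ p - fpoly c * gY \<in> Z" using c K(2) by (auto simp: Z_def)
  \<comment> \<open>The rule is y^p = (y^p - c y) + c y; the index 1 is below p because p is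
    prime.\<close>
  let ?\<beta> = "\<lambda>j. if j = 1 then c else 0"
  have "(\<Sum>j<p. fpoly (?\<beta> j) * gY ^ j) = (\<Sum>j<p. if j = 1 then fpoly c * gY else 0)"
    by (intro sum.cong) auto
  also have "\<dots> = fpoly c * gY" using p1 by simp
  finally have sum: "(\<Sum>j<p. fpoly (?\<beta> j) * gY ^ j) = fpoly c * gY" .
  have "comb Z (monomials p p) ?K = UNIV"
  proof (rule comb_monomials[OF K _ Zmult const _ ZX _ _ _ ZY])
    show "gX ^ p - (gX ^ p + fpoly 0) \<in> ?K"
      "gY ^ p - (gY ^ p - fpoly c * gY + (\<Sum>j<p. fpoly (?\<beta> j) * gY ^ j)) \<in> ?K"
      unfolding sum using left_ideal_zero[OF Kl] by simp_all
  qed (use p1 in \<open>auto simp: Z_def\<close>)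
  then show ?thesis
    by (intro core_maximal[OF L(1) finite_monomials _ _ J]) (auto simp: Z_def)
qed

section \<open>Maximal left ideals containing \<open>h\<close> and the main theorem\<close>

lemma max_two_sided_prime:
  assumes L: "max_left_ideal L" "two_sided_ideal L" and ab: "a * b \<in> L" and a: "a \<notin> L"
  shows "b \<in> L"
proof -
  note Ll = max_left_idealD(1)[OF L(1)]
  obtain r where "1 - r * a \<in> L" using max_left_idealD(3)[OF L(1) a] ..
  then have "(1 - r * a) * b \<in> L" by (rule two_sided_ideal_mult_right[OF L(2)])
  from left_ideal_add[OF Ll this left_ideal_mult[OF Ll ab, of r]] show ?thesis
    by (simp add: algebra_simps)
qed

text \<open>The inverse has to be a polynomial in x again, since it will normalise a relation with
  coefficients in F[x]; maximality of L gives only some inverse in R. With g of least degree in L,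
  division with remainder reduces f to ever smaller degree.\<close>

lemma fpoly_inverse_mod:
  assumes L: "max_left_ideal L" "two_sided_ideal L" and h: "h \<noteq> 0" "fpoly h \<in> L"
    and f: "fpoly f \<notin> L"
  shows "\<exists>u. fpoly (u * f) - 1 \<in> L"
proof -
  note Ll = max_left_idealD(1)[OF L(1)]
  obtain g where g: "g \<noteq> 0" "fpoly g \<in> L"
    and g_min: "\<And>f. f \<noteq> 0 \<Longrightarrow> fpoly f \<in> L \<Longrightarrow> Polynomial.degree g \<le> Polynomial.degree f"
    using ex_has_least_nat[of "\<lambda>g. g \<noteq> 0 \<and> fpoly g \<in> L" h Polynomial.degree] h by blast
  have small: "\<exists>u. fpoly (u * f) - 1 \<in> L"
    if "f \<noteq> 0" "Polynomial.degree f < Polynomial.degree g" for f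
    using that
  proof (induction "Polynomial.degree f" arbitrary: f rule: less_induct)
    case less
    show ?case
    proof (cases "Polynomial.degree f = 0")
      case True
      then obtain c where "f = [:c:]" by (auto elim: degree_eq_zeroE)
      then have "fpoly ([:inverse c:] * f) - 1 = 0" using less(2) by (simp flip: one_pCons)
      then show ?thesis using left_ideal_zero[OF Ll] by metis
    next
      case False
      let ?q = "g div f" and ?r = "g mod f"
      have q: "?q \<noteq> 0" using less(2,3) g(1) by (simp add: div_poly_eq_0_iff)
      \<comment> \<open>If f divided g, primeness of L would put f or the quotient into L, and both
        have smaller degree than g.\<close>
      have "?r \<noteq> 0"
      proof
        assume "?r = 0"
        then have eq: "g = ?q * f" by (metis add.right_neutral div_mult_mod_eq)
        then have "fpoly ?q * fpoly f \<in> L" using g(2) by (simp flip: fpoly_mult)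
        then have "fpoly ?q \<in> L \<or> fpoly f \<in> L" using max_two_sided_prime[OF L] by blast
        moreover have "fpoly f \<notin> L" using g_min[OF less(2)] less(3) by auto
        moreover have "Polynomial.degree g = Polynomial.degree ?q + Polynomial.degree f"
          using degree_mult_eq[OF q less(2)] eq by simp
        then have "fpoly ?q \<notin> L" using g_min[OF q] False by auto
        ultimately show False by blast
      qed
      moreover have "Polynomial.degree ?r < Polynomial.degree f"
        using degree_mod_less'[OF less(2) calculation] .
      ultimately obtain u where u: "fpoly (u * ?r) - 1 \<in> L"
        using less(1)[of ?r] less(3) by fastforce
      have "u * g = u * ?r + u * ?q * f"
        by (metis add.commute distrib_left div_mult_mod_eq mult.assoc)
      \<comment> \<open>As q f + r = g lies in L, an inverse u of r yields the inverse - u q of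
        f.\<close>
      then have "(- u * ?q) * f = u * ?r - u * g" by simp
      then have "fpoly ((- u * ?q) * f) - 1 = (fpoly (u * ?r) - 1) - fpoly u * fpoly g"
        by (simp only: fpoly_diff fpoly_mult[of u g]) simp
      then show ?thesis using left_ideal_diff[OF Ll u left_ideal_mult[OF Ll g(2)]] by metis
    qed
  qed
  let ?q = "f div g" and ?r = "f mod g"
  have split: "u * f = u * ?r + u * ?q * g" for u
    by (metis add.commute distrib_left div_mult_mod_eq mult.assoc)
  have "?r \<noteq> 0"
  proof
    assume "?r = 0"
    then have "f = ?q * g" using split[of 1] by simp
    then have "fpoly f = fpoly ?q * fpoly g" by (metis fpoly_mult)
    then show False using f left_ideal_mult[OF Ll g(2)] by metis
  qed
  then obtain u where u: "fpoly (u * ?r) - 1 \<in> L"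
    using small degree_mod_less'[OF g(1)] by blast
  have "fpoly (u * f) - 1 = (fpoly (u * ?r) - 1) + fpoly (u * ?q) * fpoly g"
    unfolding split by (simp add: fpoly_add fpoly_mult[of "u * ?q"])
  then show ?thesis using left_ideal_add[OF Ll u left_ideal_mult[OF Ll g(2)]] by metis
qed

text \<open>Leading terms are dropped while their coefficient lies in L. The first coefficient
  outside L is invertible modulo L, and dividing by it makes the relation monic. Its index is
  positive, as otherwise the constant term alone would be in L.\<close>

lemma gY_integral_relation:
  assumes L: "max_left_ideal L" "two_sided_ideal L" and h: "h \<noteq> 0" "fpoly h \<in> L"
  shows "(\<Sum>j\<le>n. fpoly (a j) * gY ^ j) \<in> L \<Longrightarrow> \<exists>j\<le>n. fpoly (a j) \<notin> L \<Longrightarrow>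
    \<exists>m>0. \<exists>\<beta>. gY ^ m - (\<Sum>j<m. fpoly (\<beta> j) * gY ^ j) \<in> L"
proof (induction n)
  case (Suc n)
  note Ll = max_left_idealD(1)[OF L(1)]
  let ?s = "\<Sum>j\<le>n. fpoly (a j) * gY ^ j"
  show ?case
  proof (cases "fpoly (a (Suc n)) \<in> L")
    case True
    then have "fpoly (a (Suc n)) * gY ^ Suc n \<in> L" by (rule two_sided_ideal_mult_right[OF L(2)])
    with Suc.prems(1) have "?s \<in> L" using left_ideal_diff[OF Ll] by fastforce
    moreover have "\<exists>j\<le>n. fpoly (a j) \<notin> L" using Suc.prems(2) True le_Suc_eq by auto
    ultimately show ?thesis by (rule Suc.IH)
  next
    case False
    then obtain u where u: "fpoly (u * a (Suc n)) - 1 \<in> L"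
      using fpoly_inverse_mod[OF L h] by blast
    let ?\<beta> = "\<lambda>j. - (u * a j)"
    have sum: "(\<Sum>j<Suc n. fpoly (?\<beta> j) * gY ^ j) = - (fpoly u * ?s)"
      by (simp add: lessThan_Suc_atMost fpoly_uminus fpoly_mult sum_negf sum_distrib_left mult.assoc)
    have "fpoly u * (\<Sum>j\<le>Suc n. fpoly (a j) * gY ^ j) - (fpoly (u * a (Suc n)) - 1) * gY ^ Suc n \<in> L"
      by (intro left_ideal_diff[OF Ll] left_ideal_mult[OF Ll Suc.prems(1)]
          two_sided_ideal_mult_right[OF L(2) u])
    also have "fpoly u * (\<Sum>j\<le>Suc n. fpoly (a j) * gY ^ j) - (fpoly (u * a (Suc n)) - 1) * gY ^ Suc n
        = gY ^ Suc n - (\<Sum>j<Suc n. fpoly (?\<beta> j) * gY ^ j)"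
      unfolding sum by (simp add: fpoly_mult algebra_simps)
    finally have "gY ^ Suc n - (\<Sum>j<Suc n. fpoly (?\<beta> j) * gY ^ j) \<in> L" .
    then show ?thesis by (intro exI[of _ "Suc n"] conjI exI[of _ ?\<beta>]) simp
  qed
qed auto

text \<open>Commutativity modulo the core makes L two-sided and equal to its core. Then h bounds the
  degree in x. Either y is in L or its inverse is a polynomial in y over F[x], which is an algebraic
  relation for y.\<close>

lemma finite_codim_commutative:
  fixes h :: "'f::field poly"
  assumes h: "h \<noteq> 0" and L: "max_left_ideal L" "Ah_ideal h \<subseteq> L" and hL: "fpoly h \<in> core L"
  obtains S where "finite S" "comb (range free_const) S L = UNIV"
proof -
  note Ll = max_left_idealD(1)[OF L(1)]
  have K: "two_sided_ideal (core L)" "Ah_ideal h \<subseteq> core L"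
    using two_sided_ideal_core[OF Ll]
      two_sided_ideal_subset_core[OF two_sided_ideal_Ah_ideal L(2)] .
  have comm: "a * b - b * a \<in> L" for a b
    using commutative_mod[OF K hL] core_subset by blast
  have "a * r \<in> L" if "a \<in> L" for a r
    using left_ideal_add[OF Ll comm[of a r] left_ideal_mult[OF Ll that, of r]] by simp
  then have "L \<subseteq> core L" by (auto simp: core_def)
  then have LL: "core L = L" using core_subset by blast
  have L2: "two_sided_ideal L" and hL: "fpoly h \<in> L" using K(1) hL by (simp_all add: LL)
  let ?m = "Polynomial.degree h"
  have m: "0 < ?m"
  proof (rule ccontr)
    assume "\<not> 0 < ?m"
    then obtain c where c: "h = [:c:]" by (auto elim: degree_eq_zeroE)
    have "fpoly [:inverse c:] * fpoly h \<in> L" by (rule left_ideal_mult[OF Ll hL])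
    then have "fpoly ([:inverse c:] * h) \<in> L" by (simp only: fpoly_mult)
    moreover have "[:inverse c:] * h = 1" using h c by (simp add: one_pCons)
    ultimately show False using max_left_idealD(2)[OF L(1)] by simp
  qed
  let ?f = "[:0, 1:] ^ ?m :: 'f poly"
  have "fpoly (?f div h) * fpoly h \<in> L" by (rule left_ideal_mult[OF Ll hL])
  also have "fpoly (?f div h) * fpoly h = gX ^ ?m - (free_const 0 + fpoly (?f mod h))"
    by (simp add: minus_mod_eq_div_mult flip: fpoly_x fpoly_power fpoly_diff fpoly_mult
        del: mult_pCons_left)
  finally have relX: "gX ^ ?m - (free_const 0 + fpoly (?f mod h)) \<in> L" .
  have degX: "Polynomial.degree (?f mod h) < ?m"
    using degree_mod_less[OF h, of ?f] m by (metis Polynomial.degree_0)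
  obtain n \<beta> where n: "0 < n" and relY: "gY ^ n - (\<Sum>j<n. fpoly (\<beta> j) * gY ^ j) \<in> L"
  proof (cases "gY \<in> L")
    case True
    then show ?thesis by (intro that[of 1 "\<lambda>_. 0"]) simp_all
  next
    case False
    then obtain r where r: "1 - r * gY \<in> L" using max_left_idealD(3)[OF L(1)] by blast
    obtain Q where "r - npoly Q \<in> Ah_ideal h" using normal_form by blast
    then have "(r - npoly Q) * gY \<in> L"
      using L(2) two_sided_ideal_mult_right[OF two_sided_ideal_Ah_ideal] by blast
    from left_ideal_add[OF Ll r this] have "1 - npoly Q * gY \<in> L" by (simp add: algebra_simps)
    then have "- (1 - npoly Q * gY) \<in> L" by (rule left_ideal_uminus[OF Ll])
    also have "- (1 - npoly Q * gY) = npoly (pCons (- 1) Q)"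
      by (simp add: npoly_pCons fpoly_uminus)
    also have "\<dots> = (\<Sum>j\<le>Suc (Polynomial.degree Q). fpoly (Polynomial.coeff (pCons (- 1) Q) j) * gY ^ j)"
      by (rule npoly_altdef) (rule degree_pCons_le)
    finally have "(\<Sum>j\<le>Suc (Polynomial.degree Q). fpoly (Polynomial.coeff (pCons (- 1) Q) j) * gY ^ j) \<in> L" .
    \<comment> \<open>The constant coefficient of the relation is -1, so not all coefficients lie in
      L.\<close>
    moreover have "- 1 \<notin> L" using left_ideal_uminus[OF Ll, of "- 1"] max_left_idealD(2)[OF L(1)] by auto
    then have "\<exists>j\<le>Suc (Polynomial.degree Q). fpoly (Polynomial.coeff (pCons (- 1) Q) j) \<notin> L"
      by (intro exI[of _ 0]) (simp add: fpoly_uminus)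
    ultimately show ?thesis using gY_integral_relation[OF L(1) L2 h hL] that by blast
  qed
  have "comb (range free_const) (monomials ?m n) L = UNIV"
  proof (rule comb_monomials[where ?z0.0 = "free_const 0" and ?z1.0 = "free_const 0" and \<beta> = \<beta>])
    show "z * w \<in> range free_const" if "z \<in> range free_const" "w \<in> range free_const" for z w :: "'f free_algebra"
      using that by (auto simp flip: free_const_mult)
    show "free_const 0 \<in> range free_const" "free_const 0 \<in> range free_const"
      by (rule rangeI)+
  qed (use L2 L(2) m n relX relY degX comm in simp_all)
  then show ?thesis using that finite_monomials by blast
qed

lemma exists_core_eq_Ah_ideal:
  fixes h :: "'f::field poly"
  assumes "CHAR('f) = 0" and h: "h \<noteq> 0"
  obtains L where "max_left_ideal L" "Ah_ideal h \<subseteq> L" "core L = Ah_ideal h"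
proof -
  note I = two_sided_ideal_Ah_ideal[of h]
  note Il = two_sided_idealD[OF I]
  let ?g = "1 - [:0, 1:] * h"
  let ?K = "{b. \<exists>a. b - a * fpoly ?g \<in> Ah_ideal h}"
  have "left_ideal ?K"
    unfolding left_ideal_def
  proof (intro conjI ballI allI)
    show "0 \<in> ?K" using left_ideal_zero[OF Il] by (auto intro!: exI[of _ 0])
    show "a + b \<in> ?K" if "a \<in> ?K" "b \<in> ?K" for a b
    proof -
      from that obtain s t where "a - s * fpoly ?g \<in> Ah_ideal h" "b - t * fpoly ?g \<in> Ah_ideal h"
        by blast
      from left_ideal_add[OF Il this] have "a + b - (s + t) * fpoly ?g \<in> Ah_ideal h"
        by (simp only: algebra_simps)
      then show ?thesis by blast
    qed
    show "r * a \<in> ?K" if "a \<in> ?K" for r a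
    proof -
      from that obtain s where "a - s * fpoly ?g \<in> Ah_ideal h" by blast
      from left_ideal_mult[OF Il this, of r] have "r * a - (r * s) * fpoly ?g \<in> Ah_ideal h"
        by (simp only: right_diff_distrib mult.assoc)
      then show ?thesis by blast
    qed
  qed
  moreover have "1 \<notin> ?K"
  proof
    assume "1 \<in> ?K"
    then obtain a where "1 - a * fpoly ?g \<in> Ah_ideal h" by blast
    \<comment> \<open>Applied to 1 in the right module, \<open>a * fpoly ?g\<close> gives a multiple
      of \<open>?g\<close>, so \<open>?g\<close> would be a unit of F[x].\<close>
    from right_op_Ah_ideal[OF this, of 1] have "1 - ?g * right_op h a 1 = 0"
      unfolding right_op_diff right_op_mult right_op_fpoly
      using right_op_fpoly[of h 1 1] by simp
    then have "?g dvd 1" by (metis dvdI eq_iff_diff_eq_0)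
    moreover from this have "?g \<noteq> 0" by (rule contrapos_pn) simp
    ultimately have "Polynomial.degree ?g = 0" using is_unit_iff_degree by blast
    moreover have "Polynomial.coeff ?g (Suc (Polynomial.degree h)) \<noteq> 0"
      using h by (simp add: one_pCons)
    ultimately show False using le_degree[of ?g "Suc (Polynomial.degree h)"] by simp
  qed
  ultimately obtain L where L: "max_left_ideal L" "?K \<subseteq> L" using exists_max_left_ideal by blast
  have "Ah_ideal h \<subseteq> ?K" by (auto intro!: exI[of _ 0])
  then have IL: "Ah_ideal h \<subseteq> L" using L(2) by blast
  note Ll = max_left_idealD(1)[OF L(1)]
  have "core L = Ah_ideal h"
  proof (rule ccontr)
    assume "core L \<noteq> Ah_ideal h"
    then have "fpoly h \<in> L" using char_0_core[OF assms L(1) IL] core_subset by blast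
    then have "fpoly [:0, 1:] * fpoly h \<in> L" by (rule left_ideal_mult[OF Ll])
    moreover have "fpoly ?g \<in> ?K" using left_ideal_zero[OF Il] by (auto intro!: exI[of _ 1])
    then have "fpoly ?g \<in> L" using L(2) by blast
    ultimately have "fpoly ?g + fpoly [:0, 1:] * fpoly h \<in> L" by (intro left_ideal_add[OF Ll])
    then show False
      using max_left_idealD(2)[OF L(1)] by (simp only: fpoly_diff fpoly_mult) simp
  qed
  with L(1) IL show ?thesis by (rule that)
qed

lemma core_maximal_or_char_0:
  fixes h :: "'f::field poly"
  assumes h: "h \<noteq> 0" and L: "max_left_ideal L" "Ah_ideal h \<subseteq> L"
    and ne: "\<not> (CHAR('f) = 0 \<and> core L = Ah_ideal h)"
    and J: "two_sided_ideal J" "core L \<subseteq> J" "J \<noteq> core L"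
  shows "1 \<in> J"
proof (cases "CHAR('f) = 0")
  case True
  then show ?thesis
    using core_maximal_commutative[OF L char_0_core[OF True h L] J] ne by blast
next
  case False
  then show ?thesis using core_maximal_char_p[OF h False L J] by blast
qed

text \<open>The map from a to a v carries a spanning set of R / L to one of M, where L is the
  annihilator of the generator v.\<close>

lemma comb_Ah_finite_dim:
  fixes M :: "('f::field free_algebra set, 'm, 'z) module_scheme"
  assumes M: "left_module (Ah h) M" and v: "v \<in> carrier M"
    and gen: "carrier M = range (\<lambda>a. Ah_proj h a \<odot>\<^bsub>M\<^esub> v)"
    and S: "finite S" "comb (range free_const) S {a. Ah_proj h a \<odot>\<^bsub>M\<^esub> v = \<zero>\<^bsub>M\<^esub>} = UNIV"
  shows "Ah_finite_dim h M"
proof -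
  interpret left_module "Ah h" M by fact
  interpret type_quotient "Ah h" "Ah_proj h" by (rule type_quotient_Ah)
  note [simp] = smult_closed
  have const: "Ah_const h c = Ah_proj h (free_const c)" for c
    by (simp add: Ah_const_def Ah_proj_def)
  let ?m = "\<lambda>a. Ah_proj h a \<odot>\<^bsub>M\<^esub> v"
  let ?B = "?m ` S"
  have B: "finite ?B" "?B \<subseteq> carrier M" using S v by auto
  have span: "\<exists>c :: 'm \<Rightarrow> 'f. ?m a = (\<Oplus>\<^bsub>M\<^esub>b\<in>?B. Ah_const h (c b) \<odot>\<^bsub>M\<^esub> b)"
    if "a \<in> comb (range free_const) S {a. ?m a = \<zero>\<^bsub>M\<^esub>}" for a
    using that
  proof induction
    case (comb_base a)
    have "(\<Oplus>\<^bsub>M\<^esub>b\<in>?B. Ah_const h 0 \<odot>\<^bsub>M\<^esub> b) = (\<Oplus>\<^bsub>M\<^esub>b\<in>?B. \<zero>\<^bsub>M\<^esub>)"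
      using B by (intro M.finsum_cong') (auto simp: const q_zero smult_zero_left v)
    then show ?case using comb_base by (intro exI[of _ "\<lambda>_. 0"]) simp
  next
    case (comb_gen z s)
    then obtain d where d: "z = free_const d" by blast
    \<comment> \<open>Coefficients are attached to vectors in \<open>?B\<close> and not to S, so
      distinct s with the same image cause no conflict.\<close>
    let ?c = "\<lambda>b. if ?m s = b then d else 0"
    have "(\<Oplus>\<^bsub>M\<^esub>b\<in>?B. Ah_const h (?c b) \<odot>\<^bsub>M\<^esub> b)
        = (\<Oplus>\<^bsub>M\<^esub>b\<in>?B. if ?m s = b then Ah_const h d \<odot>\<^bsub>M\<^esub> b else \<zero>\<^bsub>M\<^esub>)"
      using B by (intro M.finsum_cong') (auto simp: const q_zero smult_zero_left v)
    also have "\<dots> = Ah_const h d \<odot>\<^bsub>M\<^esub> ?m s"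
      using B comb_gen(2) v by (intro M.add.finprod_singleton) (auto simp: const)
    also have "\<dots> = ?m (z * s)" by (simp add: const d q_mult smult_assoc1 v)
    finally show ?case by (intro exI[of _ ?c]) (rule sym)
  next
    case (comb_add a b)
    then obtain c d :: "'m \<Rightarrow> 'f" where
      cd: "?m a = (\<Oplus>\<^bsub>M\<^esub>b\<in>?B. Ah_const h (c b) \<odot>\<^bsub>M\<^esub> b)"
        "?m b = (\<Oplus>\<^bsub>M\<^esub>b\<in>?B. Ah_const h (d b) \<odot>\<^bsub>M\<^esub> b)" by blast
    have "?m (a + b) = ?m a \<oplus>\<^bsub>M\<^esub> ?m b" by (simp add: q_add smult_l_distr v)
    also have "\<dots> = (\<Oplus>\<^bsub>M\<^esub>b\<in>?B. Ah_const h (c b) \<odot>\<^bsub>M\<^esub> b \<oplus>\<^bsub>M\<^esub> Ah_const h (d b) \<odot>\<^bsub>M\<^esub> b)"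
      unfolding cd using v by (intro M.finsum_addf[symmetric]) (auto simp: const)
    also have "\<dots> = (\<Oplus>\<^bsub>M\<^esub>b\<in>?B. Ah_const h (c b + d b) \<odot>\<^bsub>M\<^esub> b)"
      using v by (intro M.finsum_cong') (auto simp: const free_const_add q_add smult_l_distr)
    finally show ?case by (intro exI[of _ "\<lambda>b. c b + d b"])
  qed
  show ?thesis
    unfolding Ah_finite_dim_def
  proof (intro exI[of _ ?B] conjI B ballI)
    fix m assume "m \<in> carrier M"
    then obtain a where "m = ?m a" unfolding gen by blast
    then show "\<exists>c :: 'm \<Rightarrow> 'f. m = (\<Oplus>\<^bsub>M\<^esub>b\<in>?B. Ah_const h (c b) \<odot>\<^bsub>M\<^esub> b)"
      using span[of a] S(2) by blast
  qed
qed

theorem proposition5p3: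
  fixes h :: "'f::field poly"
  assumes "h \<noteq> 0"
  shows "(\<forall>P. ideal P (Ah h) \<longrightarrow>
            (primitive_ideal (Ah h) P \<longleftrightarrow>
               maximalideal P (Ah h) \<or> (CHAR('f) = 0 \<and> P = {\<zero>\<^bsub>Ah h\<^esub>}))) \<and>
         (CHAR('f) = 0 \<longrightarrow>
            primitive_ring (Ah h) \<and>
            (\<forall>M :: ('f free_algebra set, 'm) module.
               irreducible_module (Ah h) M \<and> \<not> Ah_finite_dim h M \<longrightarrow> faithful_module (Ah h) M))"
proof -
  interpret type_quotient "Ah h" "Ah_proj h" by (rule type_quotient_Ah)
  have ker: "ker = Ah_ideal h" by (rule ker_Ah_proj)
  \<comment> \<open>The zero ideal has preimage \<open>Ah_ideal h\<close>; this turns P = 0 and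
    faithfulness into statements about cores.\<close>
  have zero_iff: "P = {\<zero>\<^bsub>Ah h\<^esub>} \<longleftrightarrow> Ah_proj h -` P = Ah_ideal h" if "P \<subseteq> carrier (Ah h)" for P
  proof
    assume "P = {\<zero>\<^bsub>Ah h\<^esub>}"
    then show "Ah_proj h -` P = Ah_ideal h" by (auto simp: ker_def simp flip: ker)
  next
    assume *: "Ah_proj h -` P = Ah_ideal h"
    have "P = Ah_proj h ` ker" using image_vimage[OF that] * by (simp add: ker)
    also have "\<dots> = {\<zero>\<^bsub>Ah h\<^esub>}" using q_zero by (auto simp: ker_def intro!: image_eqI[of _ _ 0])
    finally show "P = {\<zero>\<^bsub>Ah h\<^esub>}" .
  qed
  have prim_zero: "primitive_ideal (Ah h) {\<zero>\<^bsub>Ah h\<^esub>}" if ch: "CHAR('f) = 0"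
  proof -
    obtain L where L: "max_left_ideal L" "Ah_ideal h \<subseteq> L" "core L = Ah_ideal h"
      using exists_core_eq_Ah_ideal[OF ch assms] .
    have "primitive_ideal (Ah h) (Ah_proj h ` core L)"
      using L by (intro max_left_ideal_primitive) (simp_all add: ker)
    moreover have "Ah_proj h ` core L = {\<zero>\<^bsub>Ah h\<^esub>}"
    proof (rule zero_iff[THEN iffD2])
      show "Ah_proj h -` (Ah_proj h ` core L) = Ah_ideal h"
        unfolding L(3)
        by (rule vimage_image) (simp_all add: ker two_sided_idealD[OF two_sided_ideal_Ah_ideal])
    qed (use q_closed in blast)
    ultimately show ?thesis by simp
  qed
  have "primitive_ideal (Ah h) P \<longleftrightarrow>
      maximalideal P (Ah h) \<or> (CHAR('f) = 0 \<and> P = {\<zero>\<^bsub>Ah h\<^esub>})" if P: "ideal P (Ah h)" for P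
  proof
    assume "primitive_ideal (Ah h) P"
    then obtain L where L: "max_left_ideal L" "Ah_ideal h \<subseteq> L" "Ah_proj h -` P = core L"
      using primitive_ideal_iff[OF P] by (auto simp: ker)
    have "1 \<notin> core L" using core_subset max_left_idealD(2)[OF L(1)] by blast
    then show "maximalideal P (Ah h) \<or> (CHAR('f) = 0 \<and> P = {\<zero>\<^bsub>Ah h\<^esub>})"
      unfolding maximalideal_iff[OF P] zero_iff[OF ideal_subset_carrier[OF P]] L(3)
      using core_maximal_or_char_0[OF assms L(1,2)] by blast
  qed (use maximalideal_primitive prim_zero in auto)
  moreover have "primitive_ring (Ah h)" if "CHAR('f) = 0"
    using prim_zero[OF that]
    by (auto simp: primitive_ideal_def primitive_ring_def faithful_module_def)
  moreover have "faithful_module (Ah h) M"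
    if ch: "CHAR('f) = 0" and irr: "irreducible_module (Ah h) M" and fd: "\<not> Ah_finite_dim h M"
    for M :: "('f free_algebra set, 'm) module"
  proof (rule ccontr)
    assume nf: "\<not> faithful_module (Ah h) M"
    obtain v where v: "v \<in> carrier M"
      and L: "max_left_ideal {a. Ah_proj h a \<odot>\<^bsub>M\<^esub> v = \<zero>\<^bsub>M\<^esub>}" (is "max_left_ideal ?L")
        "Ah_ideal h \<subseteq> {a. Ah_proj h a \<odot>\<^bsub>M\<^esub> v = \<zero>\<^bsub>M\<^esub>}"
      and gen: "carrier M = range (\<lambda>a. Ah_proj h a \<odot>\<^bsub>M\<^esub> v)"
      and ann: "Ah_proj h -` annihilator (Ah h) M = core {a. Ah_proj h a \<odot>\<^bsub>M\<^esub> v = \<zero>\<^bsub>M\<^esub>}"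
      using irreducible_module_max_left_ideal[OF irr] unfolding ker .
    have "annihilator (Ah h) M \<subseteq> carrier (Ah h)" by (auto simp: annihilator_def)
    then have "core ?L \<noteq> Ah_ideal h"
      using nf zero_iff[of "annihilator (Ah h) M"] by (simp add: faithful_module_def ann)
    then have "fpoly h \<in> core ?L" by (rule char_0_core[OF ch assms L])
    then obtain S where "finite S" "comb (range free_const) S ?L = UNIV"
      using finite_codim_commutative[OF assms L] by blast
    then have "Ah_finite_dim h M"
      using irr by (intro comb_Ah_finite_dim[OF _ v gen]) (auto simp: irreducible_module_def)
    with fd show False by blast
  qed
  ultimately show ?thesis by blast
qed

end
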